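(* Let $G$ be a group with finite symmetric generating set $S$ and identity $e$. Let $(X_n)_{n\ge0}$ be a finitely supported random walk on $G$ and $(Y_n)_{n\ge0}$ a coloured random walk on $G\times[r]$ that linearizes $(X_n)_{n\ge0}$, with associated stopping times $(\tau_n)_{n\ge0}$. Then the drift $\tilde\gamma$ and entropy $\tilde h$ of $(Y_n)_{n\ge0}$ are related to the drift $\gamma$ and entropy $h$ of $(X_n)_{n\ge0}$ by $$\gamma=\mathbb E[\tau_1]\,\tilde\gamma\qquad\text{and}\qquad h=\mathbb E[\tau_1]\,\tilde h .$$
   Context: Random walk on $G$: for a finitely supported probability measure $p$ on $G$ whose support generates $G$ (understood so that the walk is irreducible), $(X_n)$ is the Markov chain on $G$ with $\mathbb P[X_n=h\mid X_{n-1}=g]=p_{g^{-1}h}$, started at $e$. Coloured random walk: $[r]=\{1,\dots,r\}$ (colours); $(\tilde p_g)_{g\in G}$ are $r\times r$ matrices with non-negative entries such that $P=\sum_g\tilde p_g$ is stochastic; $(Y_n)$ is the Markov chain on $G\times[r]$ with transition probability $\tilde p_{g^{-1}h}(u,v)$ from $(g,u)$ to $(h,v)$. Its support is $\{g:\tilde p_g\ne0\}$; nearest-neighbour means support included in $S$; quasi-irreducible means that the support generates $G$ and $P$ is irreducible. Linearization: a quasi-irreducible, nearest-neighbour coloured walk $(Y_n)$ linearizes $(X_n)$ if (i) when $Y_0=(e,1)$ there are stopping times $(\tau_n)_{n\ge0}$, $\tau_0=0$, such that $(Y_{\tau_n})_{n\ge0}$ is a realization of $(X_n)_{n\ge0}$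 with initial condition $e$ (with constant colour $1$, identified with its $G$-coordinate), and (ii) the variables $\tau_{n+1}-\tau_n$ are i.i.d. with finite mean. Drift and entropy: the length of $x=g\in G$, or of $x=(g,u)\in G\times[r]$, is $|x|=|g|=\min\{k: g=s_1\cdots s_k,\ s_i\in S\}$. For a walk $(Z_n)$ on $G$ or on $G\times[r]$ with transition kernel $\mathcal Q$ and starting point $Z_0$ ($=e$, respectively $(e,u)$), the drift is $\lim_n |Z_n|/n$ and the entropy is $\lim_n -\frac1n\log\mathcal Q^n(Z_0,Z_n)$; these limits exist a.s. and in $L^1$ (by subadditivity) and are constants. *)

theory Defs
  imports "HOL-Probability.Probability" "HOL-Algebra.Generated_Groups"
begin

section \<open>Markov chains on a countable part of a type\<close>

text \<open>Time-homogeneous Markov chain with state space E, transition probabilities K and initial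
  state x0.  The product form of the Markov property avoids conditioning on null events:
  it says that, whenever the past has positive probability, the conditional
  probability of the next state y is K (x n) y.\<close>

definition markov_chain ::
  "'w measure \<Rightarrow> 's set \<Rightarrow> ('s \<Rightarrow> 's \<Rightarrow> real) \<Rightarrow> 's \<Rightarrow> (nat \<Rightarrow> 'w \<Rightarrow> 's) \<Rightarrow> bool" where
  "markov_chain M E K x0 Z \<longleftrightarrow>
     prob_space M \<and>
     (\<forall>n. Z n \<in> measurable M (count_space E)) \<and>
     (AE \<omega> in M. Z 0 \<omega> = x0) \<and>
     (\<forall>n x. \<forall>y\<in>E.
        measure M {\<omega> \<in> space M. (\<forall>i\<le>n. Z i \<omega> = x i) \<and> Z (Suc n) \<omega> = y} =
        measure M {\<omega> \<in> space M. \<forall>i\<le>n. Z i \<omega> = x i} * K (x n) y)"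

fun kernel_power :: "'s set \<Rightarrow> ('s \<Rightarrow> 's \<Rightarrow> real) \<Rightarrow> nat \<Rightarrow> 's \<Rightarrow> 's \<Rightarrow> real" where
  "kernel_power E K 0 x y = (if x = y then 1 else 0)"
| "kernel_power E K (Suc n) x y = (\<Sum>\<^sub>\<infinity>z\<in>E. kernel_power E K n x z * K z y)"

definition irreducible_kernel :: "'s set \<Rightarrow> ('s \<Rightarrow> 's \<Rightarrow> real) \<Rightarrow> bool" where
  "irreducible_kernel E K \<longleftrightarrow> (\<forall>x\<in>E. \<forall>y\<in>E. \<exists>n. kernel_power E K n x y > 0)"

section \<open>Random walks and coloured random walks on a group\<close>

definition rw_kernel :: "('a, 'b) monoid_scheme \<Rightarrow> 'a pmf \<Rightarrow> 'a \<Rightarrow> 'a \<Rightarrow> real" where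
  "rw_kernel G p g h = pmf p (inv\<^bsub>G\<^esub> g \<otimes>\<^bsub>G\<^esub> h)"

text \<open>Irreducibility of the walk means that every element of G is a product of elements of the
  support (inverses not being allowed); in particular the support generates G.\<close>

definition finitely_supported_step :: "('a, 'b) monoid_scheme \<Rightarrow> 'a pmf \<Rightarrow> bool" where
  "finitely_supported_step G p \<longleftrightarrow>
     set_pmf p \<subseteq> carrier G \<and> finite (set_pmf p) \<and> irreducible_kernel (carrier G) (rw_kernel G p)"

definition random_walk ::
  "('a, 'b) monoid_scheme \<Rightarrow> 'a pmf \<Rightarrow> 'w measure \<Rightarrow> (nat \<Rightarrow> 'w \<Rightarrow> 'a) \<Rightarrow> bool" where
  "random_walk G p M X \<longleftrightarrow> markov_chain M (carrier G) (rw_kernel G p) \<one>\<^bsub>G\<^esub> X"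

text \<open>The matrices are given by pt g u v, for g in G and colours u, v in {1..r}; values
  outside this range are irrelevant.\<close>

definition coloured_states :: "('a, 'b) monoid_scheme \<Rightarrow> nat \<Rightarrow> ('a \<times> nat) set" where
  "coloured_states G r = carrier G \<times> {1..r}"

definition coloured_kernel ::
  "('a, 'b) monoid_scheme \<Rightarrow> ('a \<Rightarrow> nat \<Rightarrow> nat \<Rightarrow> real) \<Rightarrow> 'a \<times> nat \<Rightarrow> 'a \<times> nat \<Rightarrow> real" where
  "coloured_kernel G pt x y = pt (inv\<^bsub>G\<^esub> (fst x) \<otimes>\<^bsub>G\<^esub> fst y) (snd x) (snd y)"

definition colour_matrix ::
  "('a, 'b) monoid_scheme \<Rightarrow> ('a \<Rightarrow> nat \<Rightarrow> nat \<Rightarrow> real) \<Rightarrow> nat \<Rightarrow> nat \<Rightarrow> real" where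
  "colour_matrix G pt u v = (\<Sum>\<^sub>\<infinity>g\<in>carrier G. pt g u v)"

definition coloured_step ::
  "('a, 'b) monoid_scheme \<Rightarrow> nat \<Rightarrow> ('a \<Rightarrow> nat \<Rightarrow> nat \<Rightarrow> real) \<Rightarrow> bool" where
  "coloured_step G r pt \<longleftrightarrow>
     1 \<le> r \<and>
     (\<forall>g\<in>carrier G. \<forall>u\<in>{1..r}. \<forall>v\<in>{1..r}. 0 \<le> pt g u v) \<and>
     (\<forall>u\<in>{1..r}. \<forall>v\<in>{1..r}. (\<lambda>g. pt g u v) summable_on carrier G) \<and>
     (\<forall>u\<in>{1..r}. (\<Sum>v\<in>{1..r}. colour_matrix G pt u v) = 1)"

definition coloured_support ::
  "('a, 'b) monoid_scheme \<Rightarrow> nat \<Rightarrow> ('a \<Rightarrow> nat \<Rightarrow> nat \<Rightarrow> real) \<Rightarrow> 'a set" where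
  "coloured_support G r pt = {g \<in> carrier G. \<exists>u\<in>{1..r}. \<exists>v\<in>{1..r}. pt g u v \<noteq> 0}"

definition nearest_neighbour ::
  "('a, 'b) monoid_scheme \<Rightarrow> 'a set \<Rightarrow> nat \<Rightarrow> ('a \<Rightarrow> nat \<Rightarrow> nat \<Rightarrow> real) \<Rightarrow> bool" where
  "nearest_neighbour G S r pt \<longleftrightarrow> coloured_support G r pt \<subseteq> S"

definition quasi_irreducible ::
  "('a, 'b) monoid_scheme \<Rightarrow> nat \<Rightarrow> ('a \<Rightarrow> nat \<Rightarrow> nat \<Rightarrow> real) \<Rightarrow> bool" where
  "quasi_irreducible G r pt \<longleftrightarrow>
     generate G (coloured_support G r pt) = carrier G \<and>
     irreducible_kernel {1..r} (colour_matrix G pt)"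

definition coloured_walk ::
  "('a, 'b) monoid_scheme \<Rightarrow> nat \<Rightarrow> ('a \<Rightarrow> nat \<Rightarrow> nat \<Rightarrow> real) \<Rightarrow> nat \<Rightarrow>
   'w measure \<Rightarrow> (nat \<Rightarrow> 'w \<Rightarrow> 'a \<times> nat) \<Rightarrow> bool" where
  "coloured_walk G r pt u M Y \<longleftrightarrow>
     markov_chain M (coloured_states G r) (coloured_kernel G pt) (\<one>\<^bsub>G\<^esub>, u) Y"

section \<open>Linearization\<close>

text \<open>Stopping times are almost surely finite but may be infinite on a null set
  (think of hitting times), so they take values in enat and the natural filtration is
  indexed by enat as well; its last member is generated by the whole process.\<close>

definition natural_filtration ::
  "'w measure \<Rightarrow> (nat \<Rightarrow> 'w \<Rightarrow> 's) \<Rightarrow> enat \<Rightarrow> 'w measure" where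
  "natural_filtration M Z t = sigma (space M) {Z i -` A \<inter> space M | i A. enat i \<le> t}"

text \<open>The convention at infinite time is immaterial, as it is only used on a null set.\<close>

definition stopped :: "(nat \<Rightarrow> 'w \<Rightarrow> 's) \<Rightarrow> ('w \<Rightarrow> enat) \<Rightarrow> 'w \<Rightarrow> 's" where
  "stopped Z T \<omega> = Z (the_enat (T \<omega>)) \<omega>"

definition time_increment :: "(nat \<Rightarrow> 'w \<Rightarrow> enat) \<Rightarrow> nat \<Rightarrow> 'w \<Rightarrow> real" where
  "time_increment \<tau> n \<omega> = real (the_enat (\<tau> (Suc n) \<omega>)) - real (the_enat (\<tau> n \<omega>))"

definition linearizes ::
  "('a, 'b) monoid_scheme \<Rightarrow> 'a set \<Rightarrow> nat \<Rightarrow> ('a \<Rightarrow> nat \<Rightarrow> nat \<Rightarrow> real) \<Rightarrow> 'a pmf \<Rightarrow>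
   'w measure \<Rightarrow> (nat \<Rightarrow> 'w \<Rightarrow> 'a \<times> nat) \<Rightarrow> (nat \<Rightarrow> 'w \<Rightarrow> enat) \<Rightarrow> bool" where
  "linearizes G S r pt p M Y \<tau> \<longleftrightarrow>
     coloured_step G r pt \<and> nearest_neighbour G S r pt \<and> quasi_irreducible G r pt \<and>
     coloured_walk G r pt 1 M Y \<and>
     (\<forall>n. stopping_time (natural_filtration M Y) (\<tau> n)) \<and>
     (\<forall>n. AE \<omega> in M. \<tau> n \<omega> \<noteq> \<infinity>) \<and>
     (AE \<omega> in M. \<tau> 0 \<omega> = 0) \<and>
     (\<forall>n. AE \<omega> in M. snd (stopped Y (\<tau> n) \<omega>) = 1) \<and>
     random_walk G p M (\<lambda>n \<omega>. fst (stopped Y (\<tau> n) \<omega>)) \<and>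
     prob_space.indep_vars M (\<lambda>_. borel) (time_increment \<tau>) UNIV \<and>
     (\<forall>n. distr M borel (time_increment \<tau> n) = distr M borel (time_increment \<tau> 0)) \<and>
     (\<forall>n. integrable M (time_increment \<tau> n))"

section \<open>Drift and entropy\<close>

definition word_length :: "('a, 'b) monoid_scheme \<Rightarrow> 'a set \<Rightarrow> 'a \<Rightarrow> nat" where
  "word_length G S g =
     (LEAST k. \<exists>ss. length ss = k \<and> set ss \<subseteq> S \<and> g = foldr (\<otimes>\<^bsub>G\<^esub>) ss \<one>\<^bsub>G\<^esub>)"

text \<open>The length of (g, u) is that of g, so the drift of a coloured walk Y is that of
  its first coordinate.\<close>

definition has_drift ::
  "('a, 'b) monoid_scheme \<Rightarrow> 'a set \<Rightarrow> 'w measure \<Rightarrow> (nat \<Rightarrow> 'w \<Rightarrow> 'a) \<Rightarrow> real \<Rightarrow> bool" where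
  "has_drift G S M Z c \<longleftrightarrow>
     (AE \<omega> in M. (\<lambda>n. real (word_length G S (Z n \<omega>)) / real n) \<longlonglongrightarrow> c)"

definition has_entropy ::
  "'w measure \<Rightarrow> 's set \<Rightarrow> ('s \<Rightarrow> 's \<Rightarrow> real) \<Rightarrow> 's \<Rightarrow> (nat \<Rightarrow> 'w \<Rightarrow> 's) \<Rightarrow> real \<Rightarrow> bool" where
  "has_entropy M E K x0 Z c \<longleftrightarrow>
     (AE \<omega> in M. (\<lambda>n. - ln (kernel_power E K n x0 (Z n \<omega>)) / real n) \<longlonglongrightarrow> c)"

end

(* Both quantities can be read off the one-dimensional marginals "in probability".  For the drift
   this is clear.  For the entropy, the equipartition property shows that h is the exponential
   growth rate of the number of points needed to cover Z_n with non-negligible probability.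
   Now X_n has the law of Y at time tau_n, and tau_n = n E[tau_1] + o(n) in probability by the weak
   law of large numbers.  As Y is nearest-neighbour, Y at time tau_n and Y at time n E[tau_1] are at
   word distance o(n); this changes the length by o(n), and a covering by a factor exp (o(n)), because
   balls of radius k have at most (|S| + 1)^k elements.  The initial colour plays no role, since
   the walk started at u reaches colour 1 with positive probability and the kernel is invariant
   under left translation. *)
theory Submission
  imports Defs "HOL-Real_Asymp.Real_Asymp"
begin

section \<open>Sums, convergence in probability and the weak law of large numbers\<close>

text \<open>The obstacle is the entropy. The n-step kernel of X at X_n and the kernel of Y at a
  fixed time near n E[tau_1] are probabilities of different events, and the random time gives no
  direct inequality between them. Counting the points that carry the mass removes the kernels from
  the comparison: a covering can be thickened by small balls, whereas a kernel value at one point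
  says nothing about its neighbours. Statements about marginals also allow a passage between
  probability spaces: X on N, the linearizing walk on M and the walk Y' on M' come without a joint
  law. The stopped walk and X have equal marginals; for Y and Y' there is only a one-sided
  domination up to a constant c > 0. Such a constant spoils masses near 1, so the lower half of the
  covering rate is demanded for every positive mass. Finite mean is all that is known about the
  increments of tau, so the weak law is proved by truncation.\<close>

lemma (in finite_measure) has_sum_measure_UN_countable:
  assumes "countable I" and meas: "\<And>i. i \<in> I \<Longrightarrow> A i \<in> sets M" and disj: "disjoint_family_on A I"
  shows "((\<lambda>i. measure M (A i)) has_sum measure M (\<Union>i\<in>I. A i)) I"
proof (cases "finite I")
  case True
  then have "measure M (\<Union>i\<in>I. A i) = (\<Sum>i\<in>I. measure M (A i))"
    using assms by (intro finite_measure_finite_Union) auto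
  then show ?thesis
    using True has_sum_finite[OF True, of "\<lambda>i. measure M (A i)"] by simp
next
  case False
  have bij: "bij_betw (from_nat_into I) UNIV I"
    using \<open>countable I\<close> False by (rule bij_betw_from_nat_into)
  have "disjoint_family (\<lambda>n. A (from_nat_into I n))"
    using disj bij unfolding disjoint_family_on_def bij_betw_def inj_on_def
    by (metis UNIV_I image_eqI)
  then have "(\<lambda>n. measure M (A (from_nat_into I n))) sums measure M (\<Union>n. A (from_nat_into I n))"
    using meas from_nat_into[of I] False by (intro finite_measure_UNION) auto
  moreover have "(\<Union>n. A (from_nat_into I n)) = (\<Union>i\<in>I. A i)"
    using bij by (force simp: bij_betw_def)
  \<comment> \<open>For nonnegative terms the ordered series is also an unordered sum, the notion on
    which \<open>kernel_power\<close> is built.\<close>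
  ultimately have "((\<lambda>n. measure M (A (from_nat_into I n))) has_sum measure M (\<Union>i\<in>I. A i)) UNIV"
    by (intro sums_nonneg_imp_has_sum) auto
  then show ?thesis
    using has_sum_reindex_bij_betw[OF bij, of "\<lambda>i. measure M (A i)"] by simp
qed

text \<open>The probabilities are integrals of indicators that vanish eventually at almost every
  point and are dominated by 1.\<close>

lemma (in prob_space) AE_tendsto_imp_tendsto_in_probability:
  fixes f :: "nat \<Rightarrow> 'a \<Rightarrow> real"
  assumes meas[measurable]: "\<And>n. f n \<in> borel_measurable M"
    and conv: "AE \<omega> in M. (\<lambda>n. f n \<omega>) \<longlonglongrightarrow> c" and "e > 0"
  shows "(\<lambda>n. prob {\<omega>\<in>space M. e < \<bar>f n \<omega> - c\<bar>}) \<longlonglongrightarrow> 0"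
proof -
  let ?A = "\<lambda>n. {\<omega>\<in>space M. e < \<bar>f n \<omega> - c\<bar>}"
  have "(\<lambda>n. \<integral>\<omega>. indicator (?A n) \<omega> \<partial>M) \<longlonglongrightarrow> (\<integral>\<omega>. (0::real) \<partial>M)"
  proof (rule integral_dominated_convergence[where w = "\<lambda>_. 1"])
    show "AE \<omega> in M. (\<lambda>n. indicator (?A n) \<omega> :: real) \<longlonglongrightarrow> 0"
      using conv
    proof eventually_elim
      case (elim \<omega>)
      then have "\<forall>\<^sub>F n in sequentially. dist (f n \<omega>) c < e"
        using \<open>e > 0\<close> by (rule tendstoD)
      then have "\<forall>\<^sub>F n in sequentially. (indicator (?A n) \<omega> :: real) = 0"
        by eventually_elim (auto simp: dist_real_def)
      then show ?case
        by (rule tendsto_eventually)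
    qed
  qed auto
  moreover have "(\<integral>\<omega>. indicator (?A n) \<omega> \<partial>M) = prob (?A n)" for n
    by simp
  ultimately show ?thesis by simp
qed

lemma (in prob_space) weak_law_of_large_numbers:
  fixes \<xi> :: "nat \<Rightarrow> 'a \<Rightarrow> real"
  assumes indep: "indep_vars (\<lambda>_. borel) \<xi> UNIV"
    and id: "\<And>n. distr M borel (\<xi> n) = distr M borel (\<xi> 0)"
    and int: "integrable M (\<xi> 0)" and "e > 0"
  shows "(\<lambda>n. prob {\<omega>\<in>space M. e < \<bar>(\<Sum>k<n. \<xi> k \<omega>) / n - expectation (\<xi> 0)\<bar>}) \<longlonglongrightarrow> 0"
proof (rule tendstoI)
  fix \<delta> :: real assume "\<delta> > 0"
  define m where "m = expectation (\<xi> 0)"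
  have rv[measurable]: "\<xi> k \<in> borel_measurable M" for k
    using indep by (auto simp: indep_vars_def)
  have expectation_\<xi>: "expectation (\<lambda>\<omega>. g (\<xi> k \<omega>)) = expectation (\<lambda>\<omega>. g (\<xi> 0 \<omega>))"
    if [measurable]: "g \<in> borel_measurable borel" for k and g :: "real \<Rightarrow> real"
    using id[of k] integral_distr[of "\<xi> k" M borel g] integral_distr[of "\<xi> 0" M borel g] by simp
  define t where "t = (\<lambda>(K::nat) x::real. if \<bar>x\<bar> \<le> K then x else 0)"
  have t_meas[measurable]: "t K \<in> borel_measurable borel" for K
    unfolding t_def by measurable
  \<comment> \<open>The bound e / 4 keeps the shift of the mean caused by truncation below e / 3;
    the bound e * \<delta> / 12 makes the Markov estimate 3 * d / e at most \<delta> / 4.\<close>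
  define d where "d = min (e / 4) (e * \<delta> / 12)"
  have "d > 0"
    using \<open>e > 0\<close> \<open>\<delta> > 0\<close> by (simp add: d_def)
  have "(\<lambda>K. expectation (\<lambda>\<omega>. \<bar>\<xi> 0 \<omega> - t K (\<xi> 0 \<omega>)\<bar>)) \<longlonglongrightarrow> expectation (\<lambda>\<omega>. 0)"
  proof (rule integral_dominated_convergence[where w = "\<lambda>\<omega>. \<bar>\<xi> 0 \<omega>\<bar>"])
    show "AE \<omega> in M. (\<lambda>K. \<bar>\<xi> 0 \<omega> - t K (\<xi> 0 \<omega>)\<bar>) \<longlonglongrightarrow> 0"
    proof (rule AE_I2)
      fix \<omega>
      have "\<forall>\<^sub>F K in sequentially. \<bar>\<xi> 0 \<omega>\<bar> \<le> real K"
        by real_asymp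
      then have "\<forall>\<^sub>F K in sequentially. \<bar>\<xi> 0 \<omega> - t K (\<xi> 0 \<omega>)\<bar> = 0"
        by eventually_elim (simp add: t_def)
      then show "(\<lambda>K. \<bar>\<xi> 0 \<omega> - t K (\<xi> 0 \<omega>)\<bar>) \<longlonglongrightarrow> 0"
        by (rule tendsto_eventually)
    qed
  qed (use int in \<open>auto simp: t_def\<close>)
  then have "\<forall>\<^sub>F K in sequentially. expectation (\<lambda>\<omega>. \<bar>\<xi> 0 \<omega> - t K (\<xi> 0 \<omega>)\<bar>) < d"
    using \<open>d > 0\<close> by (intro order_tendstoD) auto
  then have "\<forall>\<^sub>F K in sequentially. expectation (\<lambda>\<omega>. \<bar>\<xi> 0 \<omega> - t K (\<xi> 0 \<omega>)\<bar>) < d \<and> K > 0"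
    using eventually_gt_at_top[of 0] by eventually_elim auto
  then obtain K where K: "expectation (\<lambda>\<omega>. \<bar>\<xi> 0 \<omega> - t K (\<xi> 0 \<omega>)\<bar>) < d" "K > 0"
    by (auto dest!: eventually_happens)
  have int_\<xi>: "integrable M (\<xi> k)" for k
  proof -
    have "integrable (distr M borel (\<xi> k)) (\<lambda>x. x)"
      using id[of k] int by (simp add: integrable_distr_eq)
    then show ?thesis by (simp add: integrable_distr_eq)
  qed
  have bounded: "AE \<omega> in M. t K (\<xi> k \<omega>) \<in> {- real K..real K}" for k
    by (auto simp: t_def)
  have int_t: "integrable M (\<lambda>\<omega>. t K (\<xi> k \<omega>))" for k
    using bounded by (intro integrable_const_bound[where B = "real K"]) (auto simp: t_def)
  define b where "b = expectation (\<lambda>\<omega>. t K (\<xi> 0 \<omega>))"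
  have b: "expectation (\<lambda>\<omega>. t K (\<xi> k \<omega>)) = b" for k
    unfolding b_def by (rule expectation_\<xi>[OF t_meas])
  have "\<bar>m - b\<bar> = \<bar>expectation (\<lambda>\<omega>. \<xi> 0 \<omega> - t K (\<xi> 0 \<omega>))\<bar>"
    using int int_t by (simp add: m_def b_def)
  also have "\<dots> \<le> expectation (\<lambda>\<omega>. \<bar>\<xi> 0 \<omega> - t K (\<xi> 0 \<omega>)\<bar>)"
    by (rule integral_abs_bound)
  finally have mb: "\<bar>m - b\<bar> < e / 4"
    using K by (auto simp: d_def)
  let ?A = "\<lambda>n \<omega>. (\<Sum>k<n. t K (\<xi> k \<omega>))"
  let ?B = "\<lambda>n \<omega>. (\<Sum>k<n. \<bar>\<xi> k \<omega> - t K (\<xi> k \<omega>)\<bar>)"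
  have A: "prob {\<omega>\<in>space M. n * (e / 3) \<le> \<bar>?A n \<omega> - n * b\<bar>} \<le> 2 * exp (- (real n * e\<^sup>2 / (18 * (real K)\<^sup>2)))"
    if "n > 0" for n
  proof -
    interpret Hoeffding_ineq M "{..<n}" "\<lambda>k \<omega>. t K (\<xi> k \<omega>)" "\<lambda>_. - real K" "\<lambda>_. real K" "n * b"
    proof unfold_locales
      show "indep_vars (\<lambda>_. borel) (\<lambda>k \<omega>. t K (\<xi> k \<omega>)) {..<n}"
        by (rule indep_vars_compose2[where M' = "\<lambda>_. borel", OF indep_vars_subset[OF indep]]) auto
      show "n * b \<equiv> \<Sum>i<n. expectation (\<lambda>\<omega>. t K (\<xi> i \<omega>))"
        by (intro eq_reflection) (simp add: b)
      show "AE \<omega> in M. t K (\<xi> k \<omega>) \<in> {- real K..real K}" for k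
        by (rule bounded)
    qed simp
    have "prob {\<omega>\<in>space M. n * (e / 3) \<le> \<bar>?A n \<omega> - n * b\<bar>}
        \<le> 2 * exp (- 2 * (n * (e / 3))\<^sup>2 / (\<Sum>i<n. (real K - - real K)\<^sup>2))"
      using \<open>e > 0\<close> K(2) that by (intro Hoeffding_ineq_abs_ge) auto
    also have "- 2 * (n * (e / 3))\<^sup>2 / (\<Sum>i<n. (real K - - real K)\<^sup>2) = - (real n * e\<^sup>2 / (18 * (real K)\<^sup>2))"
      using K(2) that by (simp add: field_simps power2_eq_square)
    finally show ?thesis .
  qed
  have B: "prob {\<omega>\<in>space M. n * (e / 3) \<le> ?B n \<omega>} \<le> \<delta> / 4" if "n > 0" for n
  proof -
    have "prob {\<omega>\<in>space M. n * (e / 3) \<le> ?B n \<omega>} \<le> expectation (?B n) / (n * (e / 3))"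
      using \<open>e > 0\<close> that int_\<xi> int_t
      by (intro integral_Markov_inequality_measure[where A = "{}"]) (auto intro!: sum_nonneg)
    also have "expectation (?B n) = n * expectation (\<lambda>\<omega>. \<bar>\<xi> 0 \<omega> - t K (\<xi> 0 \<omega>)\<bar>)"
    proof -
      have "expectation (\<lambda>\<omega>. \<bar>\<xi> k \<omega> - t K (\<xi> k \<omega>)\<bar>) = expectation (\<lambda>\<omega>. \<bar>\<xi> 0 \<omega> - t K (\<xi> 0 \<omega>)\<bar>)" for k
        by (rule expectation_\<xi>[of "\<lambda>x. \<bar>x - t K x\<bar>"]) measurable
      note expectation_k = this
      have "expectation (?B n) = (\<Sum>k<n. expectation (\<lambda>\<omega>. \<bar>\<xi> k \<omega> - t K (\<xi> k \<omega>)\<bar>))"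
        using int_\<xi> int_t by (intro Bochner_Integration.integral_sum) auto
      also have "\<dots> = (\<Sum>k<n. expectation (\<lambda>\<omega>. \<bar>\<xi> 0 \<omega> - t K (\<xi> 0 \<omega>)\<bar>))"
        by (intro sum.cong refl expectation_k)
      finally show ?thesis by simp
    qed
    also have "\<dots> / (n * (e / 3)) \<le> n * d / (n * (e / 3))"
      using K \<open>e > 0\<close> by (intro divide_right_mono mult_left_mono) auto
    also have "\<dots> = 3 * d / e"
      using that by simp
    also have "\<dots> \<le> \<delta> / 4"
    proof -
      have "d \<le> e * \<delta> / 12" by (simp add: d_def)
      then show ?thesis using \<open>e > 0\<close> by (simp add: field_simps)
    qed
    finally show ?thesis .
  qed
  have "(\<lambda>n. 2 * exp (- (real n * e\<^sup>2 / (18 * (real K)\<^sup>2)))) \<longlonglongrightarrow> 0"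
    using \<open>e > 0\<close> K(2) by real_asymp
  then have "\<forall>\<^sub>F n in sequentially. 2 * exp (- (real n * e\<^sup>2 / (18 * (real K)\<^sup>2))) < \<delta> / 2"
    by (rule order_tendstoD(2)) (use \<open>\<delta> > 0\<close> in simp)
  then show "\<forall>\<^sub>F n in sequentially. dist (prob {\<omega>\<in>space M. e < \<bar>(\<Sum>k<n. \<xi> k \<omega>) / n - expectation (\<xi> 0)\<bar>}) 0 < \<delta>"
    using eventually_gt_at_top[of 0]
  proof eventually_elim
    case (elim n)
    have "{\<omega>\<in>space M. e < \<bar>(\<Sum>k<n. \<xi> k \<omega>) / n - m\<bar>}
      \<subseteq> {\<omega>\<in>space M. n * (e / 3) \<le> \<bar>?A n \<omega> - n * b\<bar>} \<union> {\<omega>\<in>space M. n * (e / 3) \<le> ?B n \<omega>}"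
    proof (intro subsetI, rule ccontr)
      fix \<omega> assume *: "\<omega> \<in> {\<omega>\<in>space M. e < \<bar>(\<Sum>k<n. \<xi> k \<omega>) / n - m\<bar>}"
        and "\<omega> \<notin> {\<omega>\<in>space M. n * (e / 3) \<le> \<bar>?A n \<omega> - n * b\<bar>} \<union> {\<omega>\<in>space M. n * (e / 3) \<le> ?B n \<omega>}"
      then have 1: "\<bar>?A n \<omega> - n * b\<bar> < n * (e / 3)" and 2: "?B n \<omega> < n * (e / 3)"
        by auto
      \<comment> \<open>Three errors of at most n * e / 3 each: the fluctuation of the truncated
        sum, the total remainder, and the shift of the mean.\<close>
      have "(\<Sum>k<n. \<xi> k \<omega>) - n * m = (?A n \<omega> - n * b) + (\<Sum>k<n. \<xi> k \<omega> - t K (\<xi> k \<omega>)) + n * (b - m)"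
        by (simp add: sum_subtractf algebra_simps)
      moreover have "\<bar>\<Sum>k<n. \<xi> k \<omega> - t K (\<xi> k \<omega>)\<bar> \<le> ?B n \<omega>"
        by (rule sum_abs)
      moreover have "\<bar>n * (b - m)\<bar> \<le> n * (e / 3)"
        unfolding abs_mult abs_of_nat using mb \<open>e > 0\<close>
        by (intro mult_left_mono) (auto simp: abs_minus_commute)
      ultimately have "\<bar>(\<Sum>k<n. \<xi> k \<omega>) - n * m\<bar> \<le> n * e"
        using 1 2 by linarith
      then have "\<bar>(\<Sum>k<n. \<xi> k \<omega>) / n - m\<bar> \<le> e"
        using elim(2) by (simp add: field_simps abs_le_iff)
      with * show False by simp
    qed
    then have "prob {\<omega>\<in>space M. e < \<bar>(\<Sum>k<n. \<xi> k \<omega>) / n - m\<bar>}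
      \<le> prob ({\<omega>\<in>space M. n * (e / 3) \<le> \<bar>?A n \<omega> - n * b\<bar>} \<union> {\<omega>\<in>space M. n * (e / 3) \<le> ?B n \<omega>})"
      by (intro finite_measure_mono) auto
    also have "\<dots> \<le> prob {\<omega>\<in>space M. n * (e / 3) \<le> \<bar>?A n \<omega> - n * b\<bar>} + prob {\<omega>\<in>space M. n * (e / 3) \<le> ?B n \<omega>}"
      by (intro measure_Un_le) auto
    also have "\<dots> < \<delta>"
      using A[OF elim(2)] B[OF elim(2)] elim(1) \<open>\<delta> > 0\<close> by linarith
    finally show ?case by (simp add: m_def)
  qed
qed

section \<open>Marginal laws of a Markov chain\<close>

lemma (in finite_measure) measure_le_add:
  assumes "A \<subseteq> B \<union> C" "B \<in> sets M" "C \<in> sets M"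
  shows "measure M A \<le> measure M B + measure M C"
proof -
  have "measure M A \<le> measure M (B \<union> C)"
    using assms by (intro finite_measure_mono sets.Un)
  also have "\<dots> \<le> measure M B + measure M C"
    using assms(2,3) by (rule measure_Un_le)
  finally show ?thesis .
qed

lemma measurable_count_space_Collect:
  assumes "Z \<in> measurable M (count_space E)"
  shows "{\<omega>\<in>space M. P (Z \<omega>)} \<in> sets M"
proof -
  have "Z -` (Collect P \<inter> E) \<inter> space M \<in> sets M"
    using assms by (rule measurable_sets) auto
  also have "Z -` (Collect P \<inter> E) \<inter> space M = {\<omega>\<in>space M. P (Z \<omega>)}"
    using measurable_space[OF assms] by auto
  finally show ?thesis .
qed

locale countable_markov_chain =
  fixes M :: "'w measure" and E :: "'s set" and K x0 and Z :: "nat \<Rightarrow> 'w \<Rightarrow> 's"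
  assumes chain: "markov_chain M E K x0 Z" and countable_states: "countable E"

sublocale countable_markov_chain \<subseteq> prob_space M
  using chain by (simp add: markov_chain_def)

context countable_markov_chain
begin

lemma measurable_chain: "Z n \<in> measurable M (count_space E)"
  using chain by (simp add: markov_chain_def)

lemma chain_start: "AE \<omega> in M. Z 0 \<omega> = x0"
  using chain unfolding markov_chain_def by blast

lemma chain_in_states: "\<omega> \<in> space M \<Longrightarrow> Z n \<omega> \<in> E"
  using measurable_space[OF measurable_chain] by auto

lemma sets_chain: "{\<omega>\<in>space M. P (Z n \<omega>)} \<in> sets M"
  by (rule measurable_count_space_Collect[OF measurable_chain])

lemma sets_chain2: "{\<omega>\<in>space M. P (Z n \<omega>) \<and> Q (Z m \<omega>)} \<in> sets M"
  by (rule sets.sets_Collect_conj[OF sets_chain sets_chain])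

lemma sets_chain_path: "{\<omega>\<in>space M. \<forall>i\<le>n. Z i \<omega> = x i} \<in> sets M"
proof -
  have "{\<omega>\<in>space M. Z i \<omega> = x i} \<in> sets M" for i
    by (rule sets_chain)
  then have "{\<omega>\<in>space M. \<forall>i\<in>{..n}. Z i \<omega> = x i} \<in> sets M"
    by (rule sets.sets_Collect_finite_All) (rule finite_atMost)
  then show ?thesis
    unfolding Ball_def atMost_iff .
qed

text \<open>\<open>markov_chain\<close> prescribes the whole past. Summing over the countably many
  paths that end in z leaves only the present state. Paths are taken in \<open>PiE\<close>, so that
  different paths differ at some time up to n and give disjoint events.\<close>

lemma prob_chain_step:
  assumes "y \<in> E"
  shows "prob {\<omega>\<in>space M. Z n \<omega> = z \<and> Z (Suc n) \<omega> = y} = prob {\<omega>\<in>space M. Z n \<omega> = z} * K z y"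
proof -
  define I where "I = {x \<in> {..n} \<rightarrow>\<^sub>E E. x n = z}"
  define A where "A = (\<lambda>x. {\<omega>\<in>space M. \<forall>i\<le>n. Z i \<omega> = x i})"
  define B where "B = (\<lambda>x. {\<omega>\<in>space M. (\<forall>i\<le>n. Z i \<omega> = x i) \<and> Z (Suc n) \<omega> = y})"
  have "countable I"
    unfolding I_def using countable_states
    by (intro countable_subset[OF _ countable_PiE[of "{..n}" "\<lambda>_. E"]]) auto
  have disjA: "disjoint_family_on A I"
    unfolding disjoint_family_on_def
  proof (intro ballI impI)
    fix x x' assume "x \<in> I" "x' \<in> I" "x \<noteq> x'"
    then obtain i where "i \<le> n" "x i \<noteq> x' i"
      unfolding I_def by (metis (no_types, lifting) PiE_ext atMost_iff mem_Collect_eq)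
    then show "A x \<inter> A x' = {}"
      unfolding A_def by fastforce
  qed
  then have disjB: "disjoint_family_on B I"
    unfolding disjoint_family_on_def A_def B_def by blast
  have path: "restrict (\<lambda>i. Z i \<omega>) {..n} \<in> I" if "\<omega> \<in> space M" "Z n \<omega> = z" for \<omega>
    using that chain_in_states by (auto simp: I_def)
  have "(\<Union>x\<in>I. A x) = {\<omega>\<in>space M. Z n \<omega> = z}"
  proof (intro equalityI subsetI)
    fix \<omega> assume "\<omega> \<in> {\<omega>\<in>space M. Z n \<omega> = z}"
    then show "\<omega> \<in> (\<Union>x\<in>I. A x)"
      using path by (intro UN_I[of "restrict (\<lambda>i. Z i \<omega>) {..n}"]) (simp_all add: A_def)
  next
    fix \<omega> assume "\<omega> \<in> (\<Union>x\<in>I. A x)"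
    then obtain x where "x n = z" "\<omega> \<in> A x"
      unfolding I_def by blast
    then show "\<omega> \<in> {\<omega>\<in>space M. Z n \<omega> = z}"
      by (simp add: A_def)
  qed
  moreover have "A x \<in> sets M" for x
    unfolding A_def by (rule sets_chain_path)
  ultimately have sumA: "((\<lambda>x. prob (A x)) has_sum prob {\<omega>\<in>space M. Z n \<omega> = z}) I"
    using has_sum_measure_UN_countable[OF \<open>countable I\<close> _ disjA] by simp
  have "(\<Union>x\<in>I. B x) = {\<omega>\<in>space M. Z n \<omega> = z \<and> Z (Suc n) \<omega> = y}"
  proof (intro equalityI subsetI)
    fix \<omega> assume "\<omega> \<in> {\<omega>\<in>space M. Z n \<omega> = z \<and> Z (Suc n) \<omega> = y}"
    then show "\<omega> \<in> (\<Union>x\<in>I. B x)"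
      using path by (intro UN_I[of "restrict (\<lambda>i. Z i \<omega>) {..n}"]) (simp_all add: B_def)
  next
    fix \<omega> assume "\<omega> \<in> (\<Union>x\<in>I. B x)"
    then obtain x where "x n = z" "\<omega> \<in> B x"
      unfolding I_def by blast
    then show "\<omega> \<in> {\<omega>\<in>space M. Z n \<omega> = z \<and> Z (Suc n) \<omega> = y}"
      by (simp add: B_def)
  qed
  moreover have "B x \<in> sets M" for x
    unfolding B_def by (rule sets.sets_Collect_conj[OF sets_chain[of "\<lambda>v. v = y"] sets_chain_path])
  ultimately have sumB: "((\<lambda>x. prob (B x)) has_sum
      prob {\<omega>\<in>space M. Z n \<omega> = z \<and> Z (Suc n) \<omega> = y}) I"
    using has_sum_measure_UN_countable[OF \<open>countable I\<close> _ disjB] by simp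
  have "prob (B x) = prob (A x) * K (x n) y" for x
    using chain \<open>y \<in> E\<close> unfolding markov_chain_def A_def B_def by blast
  then have "prob (B x) = prob (A x) * K z y" if "x \<in> I" for x
    using that by (simp add: I_def)
  then have "((\<lambda>x. prob (A x) * K z y) has_sum
      prob {\<omega>\<in>space M. Z n \<omega> = z \<and> Z (Suc n) \<omega> = y}) I"
    using sumB by (simp cong: has_sum_cong)
  then show ?thesis
    using has_sum_cmult_left[OF sumA, of "K z y"] by (rule has_sum_unique)
qed

lemma has_sum_prob_chain:
  assumes "B \<subseteq> E" and "\<And>z. {\<omega>\<in>space M. P z \<omega>} \<in> sets M"
  shows "((\<lambda>z. prob {\<omega>\<in>space M. Z n \<omega> = z \<and> P z \<omega>}) has_sum
      prob {\<omega>\<in>space M. Z n \<omega> \<in> B \<and> P (Z n \<omega>) \<omega>}) B"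
proof -
  have "((\<lambda>z. prob {\<omega>\<in>space M. Z n \<omega> = z \<and> P z \<omega>}) has_sum
      prob (\<Union>z\<in>B. {\<omega>\<in>space M. Z n \<omega> = z \<and> P z \<omega>})) B"
  proof (rule has_sum_measure_UN_countable)
    show "countable B"
      using \<open>B \<subseteq> E\<close> countable_states by (rule countable_subset)
    show "{\<omega>\<in>space M. Z n \<omega> = z \<and> P z \<omega>} \<in> sets M" for z
      by (rule sets.sets_Collect_conj[OF assms(2) sets_chain])
  qed (auto simp: disjoint_family_on_def)
  also have "(\<Union>z\<in>B. {\<omega>\<in>space M. Z n \<omega> = z \<and> P z \<omega>}) = {\<omega>\<in>space M. Z n \<omega> \<in> B \<and> P (Z n \<omega>) \<omega>}"
    by auto
  finally show ?thesis .
qed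

lemma has_sum_prob_chain_step:
  assumes "y \<in> E"
  shows "((\<lambda>z. prob {\<omega>\<in>space M. Z n \<omega> = z} * K z y) has_sum prob {\<omega>\<in>space M. Z (Suc n) \<omega> = y}) E"
proof -
  have "((\<lambda>z. prob {\<omega>\<in>space M. Z n \<omega> = z \<and> Z (Suc n) \<omega> = y}) has_sum
      prob {\<omega>\<in>space M. Z n \<omega> \<in> E \<and> Z (Suc n) \<omega> = y}) E"
    using sets_chain[of "\<lambda>x. x = y" "Suc n"]
      has_sum_prob_chain[of E "\<lambda>_ \<omega>. Z (Suc n) \<omega> = y" n] by simp
  moreover have "{\<omega>\<in>space M. Z n \<omega> \<in> E \<and> Z (Suc n) \<omega> = y} = {\<omega>\<in>space M. Z (Suc n) \<omega> = y}"
    using chain_in_states by auto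
  ultimately show ?thesis
    using prob_chain_step[OF assms] by simp
qed

text \<open>This is the source of nonnegativity and summability for kernel powers: an
  \<open>infsum\<close> that does not converge would be 0 by convention, and probabilities exclude
  that. It also makes the marginals of two realizations of the same chain agree.\<close>

lemma prob_chain_eq_kernel_power:
  assumes "y \<in> E"
  shows "prob {\<omega>\<in>space M. Z n \<omega> = y} = kernel_power E K n x0 y"
  using assms
proof (induction n arbitrary: y)
  case 0
  have "prob {\<omega>\<in>space M. Z 0 \<omega> = y} = prob {\<omega>\<in>space M. x0 = y}"
  proof (rule measure_eq_AE)
    show "AE \<omega> in M. \<omega> \<in> {\<omega>\<in>space M. Z 0 \<omega> = y} \<longleftrightarrow> \<omega> \<in> {\<omega>\<in>space M. x0 = y}"
      using chain_start by eventually_elim auto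
    show "{\<omega>\<in>space M. Z 0 \<omega> = y} \<in> events"
      by (rule sets_chain)
    show "{\<omega>\<in>space M. x0 = y} \<in> events"
      by (rule sets_chain[of "\<lambda>_. x0 = y"])
  qed
  then show ?case
    by (simp add: prob_space)
next
  case (Suc n)
  have "kernel_power E K (Suc n) x0 y = (\<Sum>\<^sub>\<infinity>z\<in>E. prob {\<omega>\<in>space M. Z n \<omega> = z} * K z y)"
    using Suc.IH by (simp cong: infsum_cong)
  then show ?case
    using infsumI[OF has_sum_prob_chain_step[OF Suc.prems, of n]] by simp
qed

lemma has_sum_kernel_power:
  assumes "B \<subseteq> E"
  shows "(kernel_power E K n x0 has_sum prob {\<omega>\<in>space M. Z n \<omega> \<in> B}) B"
proof -
  have "((\<lambda>z. prob {\<omega>\<in>space M. Z n \<omega> = z}) has_sum prob {\<omega>\<in>space M. Z n \<omega> \<in> B}) B"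
    using has_sum_prob_chain[OF assms, where P = "\<lambda>_ _. True"] by simp
  then show ?thesis
    using prob_chain_eq_kernel_power assms by (simp add: subset_iff cong: has_sum_cong)
qed

lemma has_sum_kernel_power_step:
  assumes "y \<in> E"
  shows "((\<lambda>z. kernel_power E K n x0 z * K z y) has_sum kernel_power E K (Suc n) x0 y) E"
proof -
  have "((\<lambda>z. prob {\<omega>\<in>space M. Z n \<omega> = z} * K z y) has_sum kernel_power E K (Suc n) x0 y) E"
    using has_sum_prob_chain_step[OF assms, of n]
    unfolding prob_chain_eq_kernel_power[OF assms, of "Suc n"] .
  then show ?thesis
    using prob_chain_eq_kernel_power by (simp cong: has_sum_cong)
qed

text \<open>Only countably many triples (n, z, y) have to be excluded, and each of them is a null
  event.\<close>

lemma AE_chain_transition: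
  assumes "\<And>z y. z \<in> E \<Longrightarrow> y \<in> E \<Longrightarrow> \<not> Q z y \<Longrightarrow> K z y = 0"
  shows "AE \<omega> in M. \<forall>n. Q (Z n \<omega>) (Z (Suc n) \<omega>)"
proof -
  have "AE \<omega> in M. \<not> (Z n \<omega> = z \<and> Z (Suc n) \<omega> = y)" if "z \<in> E" "y \<in> E" "\<not> Q z y" for n z y
  proof (rule AE_I)
    show "emeasure M {\<omega>\<in>space M. Z n \<omega> = z \<and> Z (Suc n) \<omega> = y} = 0"
      using prob_chain_step[OF \<open>y \<in> E\<close>, of n z] assms[OF that] by (simp add: emeasure_eq_measure)
    show "{\<omega>\<in>space M. Z n \<omega> = z \<and> Z (Suc n) \<omega> = y} \<in> events"
      by (rule sets_chain2)
  qed auto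
  then have "AE \<omega> in M. \<forall>n. \<forall>z\<in>E. \<forall>y\<in>E. \<not> Q z y \<longrightarrow> \<not> (Z n \<omega> = z \<and> Z (Suc n) \<omega> = y)"
    using countable_states
    by (intro AE_all_countable[THEN iffD2] AE_ball_countable[THEN iffD2] allI ballI) auto
  then show ?thesis
    using AE_space
  proof eventually_elim
    case (elim \<omega>)
    then show ?case
      using chain_in_states[OF elim(2)] by metis
  qed
qed

end

section \<open>Entropy as a covering rate\<close>

text \<open>The number a is the exponential growth rate of the smallest sets that carry the law of W
  n. The first half covers all but an arbitrarily small mass; the second half says that even a small
  fixed mass c needs as many points, up to subexponential factors. Only the law of each single W n
  enters.\<close>

definition covering_rate :: "'w measure \<Rightarrow> (nat \<Rightarrow> 'w \<Rightarrow> 's) \<Rightarrow> real \<Rightarrow> bool" where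
  "covering_rate M W a \<longleftrightarrow>
     (\<forall>\<epsilon>>0. \<forall>\<delta>>0. \<forall>\<^sub>F n in sequentially. \<exists>A. finite A \<and>
        real (card A) \<le> exp (real n * (a + \<epsilon>)) \<and> measure M {\<omega>\<in>space M. W n \<omega> \<notin> A} \<le> \<delta>) \<and>
     (\<forall>\<epsilon>>0. \<forall>c>0. \<forall>\<^sub>F n in sequentially. \<forall>A. finite A \<longrightarrow>
        c \<le> measure M {\<omega>\<in>space M. W n \<omega> \<in> A} \<longrightarrow> exp (real n * (a - \<epsilon>)) \<le> real (card A))"

lemma covering_rateI:
  assumes "\<And>\<epsilon> \<delta>. \<epsilon> > 0 \<Longrightarrow> \<delta> > 0 \<Longrightarrow> \<forall>\<^sub>F n in sequentially. \<exists>A. finite A \<and>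
        real (card A) \<le> exp (real n * (a + \<epsilon>)) \<and> measure M {\<omega>\<in>space M. W n \<omega> \<notin> A} \<le> \<delta>"
    and "\<And>\<epsilon> c. \<epsilon> > 0 \<Longrightarrow> c > 0 \<Longrightarrow> \<forall>\<^sub>F n in sequentially. \<forall>A. finite A \<longrightarrow>
        c \<le> measure M {\<omega>\<in>space M. W n \<omega> \<in> A} \<longrightarrow> exp (real n * (a - \<epsilon>)) \<le> real (card A)"
  shows "covering_rate M W a"
  using assms unfolding covering_rate_def by blast

lemma covering_rate_upperD:
  assumes "covering_rate M W a" "\<epsilon> > 0" "\<delta> > 0"
  shows "\<forall>\<^sub>F n in sequentially. \<exists>A. finite A \<and>
    real (card A) \<le> exp (real n * (a + \<epsilon>)) \<and> measure M {\<omega>\<in>space M. W n \<omega> \<notin> A} \<le> \<delta>"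
  using assms unfolding covering_rate_def by blast

lemma covering_rate_lowerD:
  assumes "covering_rate M W a" "\<epsilon> > 0" "c > 0"
  shows "\<forall>\<^sub>F n in sequentially. \<forall>A. finite A \<longrightarrow>
    c \<le> measure M {\<omega>\<in>space M. W n \<omega> \<in> A} \<longrightarrow> exp (real n * (a - \<epsilon>)) \<le> real (card A)"
  using assms unfolding covering_rate_def by blast

section \<open>Equipartition: from pointwise entropy to covering rates\<close>

context countable_markov_chain
begin

lemma kernel_power_nonneg: "y \<in> E \<Longrightarrow> kernel_power E K n x0 y \<ge> 0"
  using prob_chain_eq_kernel_power[of y n] by (metis measure_nonneg)

lemma sum_kernel_power:
  assumes "finite F" "F \<subseteq> E"
  shows "(\<Sum>y\<in>F. kernel_power E K n x0 y) = prob {\<omega>\<in>space M. Z n \<omega> \<in> F}"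
  using infsumI[OF has_sum_kernel_power[OF assms(2), of n]] assms(1) by simp

text \<open>The total mass is at most 1. Finite subsets are bounded first, because F might be
  infinite a priori and then \<open>card F\<close> would be 0.\<close>

lemma card_heavy_states_le:
  assumes "t > 0" "F \<subseteq> E" "\<And>y. y \<in> F \<Longrightarrow> t \<le> kernel_power E K n x0 y"
  shows "finite F \<and> real (card F) \<le> 1 / t"
proof -
  have bound: "real (card F') \<le> 1 / t" if "finite F'" "F' \<subseteq> F" for F'
  proof -
    have "real (card F') * t \<le> (\<Sum>y\<in>F'. kernel_power E K n x0 y)"
      using assms that by (intro sum_bounded_below) auto
    also have "\<dots> = prob {\<omega>\<in>space M. Z n \<omega> \<in> F'}"
      using that assms by (intro sum_kernel_power) auto
    also have "\<dots> \<le> 1"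
      by (rule prob_le_1)
    finally show ?thesis
      using \<open>t > 0\<close> by (simp add: field_simps)
  qed
  moreover have "finite F"
  proof (rule ccontr)
    assume "infinite F"
    then obtain F' where "finite F'" "card F' = Suc (nat \<lceil>1 / t\<rceil>)" "F' \<subseteq> F"
      using infinite_arbitrarily_large by blast
    then show False
      using bound[of F'] by linarith
  qed
  ultimately show ?thesis by blast
qed

text \<open>Typical states at time n have mass exp (- n (h + o(1))). There are at most exp (n (h +
  \<epsilon>)) states of mass at least exp (- n (h + \<epsilon>)), and these form the covering.
  Conversely, a set of probability c must collect that probability from typical points of small
  mass, so it has many of them.\<close>

lemma entropy_imp_covering_rate:
  assumes "has_entropy M E K x0 Z h"
  shows "covering_rate M Z h"
proof -
  let ?k = "\<lambda>n. kernel_power E K n x0"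
  define q where "q = (\<lambda>n \<omega>. - ln (?k n (Z n \<omega>)) / real n)"
  have q_meas[measurable]: "q n \<in> borel_measurable M" for n
    unfolding q_def by (rule measurable_compose[OF measurable_chain]) simp
  have q_sets: "{\<omega>\<in>space M. e < \<bar>q n \<omega> - h\<bar>} \<in> events" for n e
    by measurable
  have q_lim: "(\<lambda>n. prob {\<omega>\<in>space M. e < \<bar>q n \<omega> - h\<bar>}) \<longlonglongrightarrow> 0" if "e > 0" for e
  proof (rule AE_tendsto_imp_tendsto_in_probability[OF q_meas _ that])
    show "AE \<omega> in M. (\<lambda>n. q n \<omega>) \<longlonglongrightarrow> h"
      using assms unfolding has_entropy_def q_def .
  qed
  show ?thesis
  proof (rule covering_rateI)
    fix \<epsilon> \<delta> :: real assume "\<epsilon> > 0" "\<delta> > 0"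
    show "\<forall>\<^sub>F n in sequentially. \<exists>A. finite A \<and>
        real (card A) \<le> exp (real n * (h + \<epsilon>)) \<and> prob {\<omega>\<in>space M. Z n \<omega> \<notin> A} \<le> \<delta>"
      using order_tendstoD(2)[OF q_lim[OF \<open>\<epsilon> > 0\<close>] \<open>\<delta> > 0\<close>] eventually_gt_at_top[of 0]
    proof eventually_elim
      case (elim n)
      define A where "A = {y\<in>E. exp (- (real n * (h + \<epsilon>))) \<le> ?k n y}"
      have "finite A \<and> real (card A) \<le> 1 / exp (- (real n * (h + \<epsilon>)))"
        by (rule card_heavy_states_le) (auto simp: A_def)
      then have A: "finite A" "real (card A) \<le> exp (real n * (h + \<epsilon>))"
        using exp_minus_inverse[of "real n * (h + \<epsilon>)"]
        by (simp_all only: nonzero_eq_divide_eq[OF exp_not_eq_zero, symmetric])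
      \<comment> \<open>States of kernel value 0 are treated apart, since \<open>ln 0 = 0\<close>
        would make them look like states of mass 1; they are almost surely not visited.\<close>
      define B where "B = {y\<in>E. ?k n y = 0}"
      have "(?k n has_sum 0) B"
        by (rule has_sum_0) (simp add: B_def)
      moreover have "(?k n has_sum prob {\<omega>\<in>space M. Z n \<omega> \<in> B}) B"
        by (rule has_sum_kernel_power) (auto simp: B_def)
      ultimately have B: "prob {\<omega>\<in>space M. Z n \<omega> \<in> B} = 0"
        using has_sum_unique by blast
      have "{\<omega>\<in>space M. Z n \<omega> \<notin> A} \<subseteq> {\<omega>\<in>space M. \<epsilon> < \<bar>q n \<omega> - h\<bar>} \<union> {\<omega>\<in>space M. Z n \<omega> \<in> B}"
      proof (rule subsetI, rule UnCI)
        fix \<omega> assume \<omega>: "\<omega> \<in> {\<omega>\<in>space M. Z n \<omega> \<notin> A}" "\<omega> \<notin> {\<omega>\<in>space M. Z n \<omega> \<in> B}"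
        then have Z: "Z n \<omega> \<in> E"
          using chain_in_states by auto
        with \<omega> have pos: "?k n (Z n \<omega>) > 0"
          using kernel_power_nonneg[OF Z, of n] by (auto simp: B_def simp del: kernel_power.simps)
        have "?k n (Z n \<omega>) < exp (- (real n * (h + \<epsilon>)))"
          using \<omega> Z by (auto simp: A_def)
        then have "ln (?k n (Z n \<omega>)) < - (real n * (h + \<epsilon>))"
          using pos by (metis ln_exp ln_less_cancel_iff exp_gt_zero)
        then have "h + \<epsilon> < q n \<omega>"
          using elim(2) by (simp add: q_def field_simps)
        then show "\<omega> \<in> {\<omega>\<in>space M. \<epsilon> < \<bar>q n \<omega> - h\<bar>}"
          using \<omega> by auto
      qed
      then have "prob {\<omega>\<in>space M. Z n \<omega> \<notin> A}
          \<le> prob {\<omega>\<in>space M. \<epsilon> < \<bar>q n \<omega> - h\<bar>} + prob {\<omega>\<in>space M. Z n \<omega> \<in> B}"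
        by (rule measure_le_add[OF _ q_sets sets_chain])
      then have "prob {\<omega>\<in>space M. Z n \<omega> \<notin> A} \<le> \<delta>"
        using B elim by simp
      with A show ?case by blast
    qed
  next
    fix \<epsilon> c :: real assume "\<epsilon> > 0" "c > 0"
    \<comment> \<open>Half of \<epsilon> is spent on the typical mass of a point, the other half on
      absorbing the constant c / 2.\<close>
    have "(\<lambda>n. exp (- (real n * (\<epsilon> / 2)))) \<longlonglongrightarrow> 0"
      using \<open>\<epsilon> > 0\<close> by real_asymp
    then have ev: "\<forall>\<^sub>F n in sequentially. exp (- (real n * (\<epsilon> / 2))) < c / 2"
      using \<open>c > 0\<close> by (intro order_tendstoD(2)[where y = 0]) auto
    have "\<forall>\<^sub>F n in sequentially. prob {\<omega>\<in>space M. \<epsilon> / 2 < \<bar>q n \<omega> - h\<bar>} < c / 2"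
      using \<open>\<epsilon> > 0\<close> \<open>c > 0\<close> by (intro order_tendstoD(2)[OF q_lim]) auto
    with ev show "\<forall>\<^sub>F n in sequentially. \<forall>A. finite A \<longrightarrow>
        c \<le> prob {\<omega>\<in>space M. Z n \<omega> \<in> A} \<longrightarrow> exp (real n * (h - \<epsilon>)) \<le> real (card A)"
      using eventually_gt_at_top[of 0]
    proof eventually_elim
      case (elim n)
      show ?case
      proof (intro allI impI)
        fix A assume A: "finite A" "c \<le> prob {\<omega>\<in>space M. Z n \<omega> \<in> A}"
        let ?t = "exp (- (real n * (h - \<epsilon> / 2)))"
        \<comment> \<open>Points of A heavier than \<open>?t\<close> are atypical and have total
          probability below c / 2. So B keeps more than c / 2, although each of its points
          contributes at most \<open>?t\<close>.\<close>
        define B where "B = {y\<in>A \<inter> E. ?k n y \<le> ?t}"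
        have "{\<omega>\<in>space M. Z n \<omega> \<in> A}
            \<subseteq> {\<omega>\<in>space M. \<epsilon> / 2 < \<bar>q n \<omega> - h\<bar>} \<union> {\<omega>\<in>space M. Z n \<omega> \<in> B}"
        proof (rule subsetI, rule UnCI)
          fix \<omega> assume \<omega>: "\<omega> \<in> {\<omega>\<in>space M. Z n \<omega> \<in> A}" "\<omega> \<notin> {\<omega>\<in>space M. Z n \<omega> \<in> B}"
          then have "?t < ?k n (Z n \<omega>)"
            using chain_in_states by (auto simp: B_def)
          then have "- (real n * (h - \<epsilon> / 2)) < ln (?k n (Z n \<omega>))"
            by (metis ln_exp ln_less_cancel_iff exp_gt_zero order.strict_trans)
          then have "q n \<omega> < h - \<epsilon> / 2"
            using elim(3) by (simp add: q_def field_simps)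
          then have "\<epsilon> / 2 < \<bar>q n \<omega> - h\<bar>"
            by linarith
          then show "\<omega> \<in> {\<omega>\<in>space M. \<epsilon> / 2 < \<bar>q n \<omega> - h\<bar>}"
            using \<omega> by blast
        qed
        then have "prob {\<omega>\<in>space M. Z n \<omega> \<in> A}
            \<le> prob {\<omega>\<in>space M. \<epsilon> / 2 < \<bar>q n \<omega> - h\<bar>} + prob {\<omega>\<in>space M. Z n \<omega> \<in> B}"
          by (rule measure_le_add[OF _ q_sets sets_chain])
        also have "prob {\<omega>\<in>space M. Z n \<omega> \<in> B} = (\<Sum>y\<in>B. ?k n y)"
          using A by (intro sum_kernel_power[symmetric]) (auto simp: B_def)
        also have "\<dots> \<le> real (card B) * ?t"
          by (rule sum_bounded_above) (auto simp: B_def)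
        also have "\<dots> \<le> real (card A) * ?t"
          using A by (intro mult_right_mono) (auto simp: B_def intro!: card_mono)
        finally have "exp (- (real n * (\<epsilon> / 2))) \<le> real (card A) * ?t"
          using A elim by linarith
        then have "exp (- (real n * (\<epsilon> / 2))) / ?t \<le> real (card A)"
          by (simp add: divide_le_eq)
        also have "exp (- (real n * (\<epsilon> / 2))) / ?t = exp (real n * (h - \<epsilon>))"
          unfolding exp_diff[symmetric] by (simp add: algebra_simps)
        finally show "exp (real n * (h - \<epsilon>)) \<le> real (card A)" .
      qed
    qed
  qed
qed

end

section \<open>Covering rates under time change, comparison of laws, loss of the colour and small
  displacements\<close>

lemma covering_rate_reindex:
  assumes cov: "covering_rate M W a" and "m \<ge> 0"
    and j: "filterlim j at_top sequentially" "(\<lambda>n. real (j n) / real n) \<longlonglongrightarrow> m"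
  shows "covering_rate M (\<lambda>n. W (j n)) (m * a)"
proof (rule covering_rateI)
  fix \<epsilon> \<delta> :: real assume "\<epsilon> > 0" "\<delta> > 0"
  \<comment> \<open>An error of \<epsilon>' per unit of the time j n costs about m * \<epsilon>' per
    unit of n. The added 1 makes this strictly smaller than \<epsilon> and covers m = 0.\<close>
  define \<epsilon>' where "\<epsilon>' = \<epsilon> / (m + 1)"
  have \<epsilon>': "\<epsilon>' > 0" "m * \<epsilon>' < \<epsilon>"
    using \<open>\<epsilon> > 0\<close> \<open>m \<ge> 0\<close> by (auto simp: \<epsilon>'_def field_simps)
  have "(\<lambda>n. real (j n) / real n * (a + \<epsilon>')) \<longlonglongrightarrow> m * (a + \<epsilon>')"
    by (intro tendsto_intros j)
  moreover have "m * (a + \<epsilon>') < m * a + \<epsilon>"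
    using \<epsilon>' by (simp add: algebra_simps)
  ultimately have "\<forall>\<^sub>F n in sequentially. real (j n) / real n * (a + \<epsilon>') < m * a + \<epsilon>"
    by (rule order_tendstoD(2))
  with eventually_compose_filterlim[OF covering_rate_upperD[OF cov \<epsilon>'(1) \<open>\<delta> > 0\<close>] j(1)]
  show "\<forall>\<^sub>F n in sequentially. \<exists>A. finite A \<and> real (card A) \<le> exp (real n * (m * a + \<epsilon>)) \<and>
      measure M {\<omega>\<in>space M. W (j n) \<omega> \<notin> A} \<le> \<delta>"
    using eventually_gt_at_top[of 0]
  proof eventually_elim
    case (elim n)
    have "real (j n) * (a + \<epsilon>') \<le> real n * (m * a + \<epsilon>)"
      using elim by (simp add: field_simps)
    then have "exp (real (j n) * (a + \<epsilon>')) \<le> exp (real n * (m * a + \<epsilon>))"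
      by simp
    with elim(1) show ?case
      by (meson order_trans)
  qed
next
  fix \<epsilon> c :: real assume "\<epsilon> > 0" "c > 0"
  define \<epsilon>' where "\<epsilon>' = \<epsilon> / (m + 1)"
  have \<epsilon>': "\<epsilon>' > 0" "m * \<epsilon>' < \<epsilon>"
    using \<open>\<epsilon> > 0\<close> \<open>m \<ge> 0\<close> by (auto simp: \<epsilon>'_def field_simps)
  have "(\<lambda>n. real (j n) / real n * (a - \<epsilon>')) \<longlonglongrightarrow> m * (a - \<epsilon>')"
    by (intro tendsto_intros j)
  moreover have "m * a - \<epsilon> < m * (a - \<epsilon>')"
    using \<epsilon>' by (simp add: algebra_simps)
  ultimately have "\<forall>\<^sub>F n in sequentially. m * a - \<epsilon> < real (j n) / real n * (a - \<epsilon>')"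
    by (rule order_tendstoD(1))
  with eventually_compose_filterlim[OF covering_rate_lowerD[OF cov \<epsilon>'(1) \<open>c > 0\<close>] j(1)]
  show "\<forall>\<^sub>F n in sequentially. \<forall>A. finite A \<longrightarrow> c \<le> measure M {\<omega>\<in>space M. W (j n) \<omega> \<in> A} \<longrightarrow>
      exp (real n * (m * a - \<epsilon>)) \<le> real (card A)"
    using eventually_gt_at_top[of 0]
  proof eventually_elim
    case (elim n)
    have "real n * (m * a - \<epsilon>) \<le> real (j n) * (a - \<epsilon>')"
      using elim by (simp add: field_simps)
    then have "exp (real n * (m * a - \<epsilon>)) \<le> exp (real (j n) * (a - \<epsilon>'))"
      by simp
    with elim(1) show ?case
      by (meson order_trans)
  qed
qed

text \<open>Domination in one direction gives both halves. A covering for Z pulls back along f to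
  one for W, without more points because f is injective, and the uncovered mass grows at most by the
  factor 1 / c. A set that has mass d for W pushes forward to one of mass at least c * d for Z, so
  it cannot be too small.\<close>

lemma covering_rate_transfer:
  assumes cov: "covering_rate M' Z a" and "finite_measure M'" and "c > 0" and inj: "inj_on f E"
    and Z: "\<And>n. Z n \<in> measurable M' (count_space E')"
    and W: "\<And>n \<omega>. \<omega> \<in> space M \<Longrightarrow> W n \<omega> \<in> E"
    and le: "\<And>n B. B \<subseteq> E \<Longrightarrow>
      c * measure M {\<omega>\<in>space M. W n \<omega> \<in> B} \<le> measure M' {\<omega>\<in>space M'. Z n \<omega> \<in> f ` B}"
  shows "covering_rate M W a"
proof (rule covering_rateI)
  interpret finite_measure M' by fact
  fix \<epsilon> \<delta> :: real assume "\<epsilon> > 0" "\<delta> > 0"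
  then have "c * \<delta> > 0"
    using \<open>c > 0\<close> by simp
  show "\<forall>\<^sub>F n in sequentially. \<exists>A. finite A \<and>
      real (card A) \<le> exp (real n * (a + \<epsilon>)) \<and> measure M {\<omega>\<in>space M. W n \<omega> \<notin> A} \<le> \<delta>"
    using covering_rate_upperD[OF cov \<open>\<epsilon> > 0\<close> \<open>c * \<delta> > 0\<close>]
  proof eventually_elim
    case (elim n)
    then obtain A' where A': "finite A'" "real (card A') \<le> exp (real n * (a + \<epsilon>))"
      "measure M' {\<omega>\<in>space M'. Z n \<omega> \<notin> A'} \<le> c * \<delta>"
      by blast
    define A where "A = {x\<in>E. f x \<in> A'}"
    have injA: "inj_on f A" "f ` A \<subseteq> A'"
      using inj by (auto simp: A_def intro: inj_on_subset)
    have A: "finite A" "card A \<le> card A'"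
      using injA A' by (auto intro: inj_on_finite card_inj_on_le)
    have "c * measure M {\<omega>\<in>space M. W n \<omega> \<notin> A} = c * measure M {\<omega>\<in>space M. W n \<omega> \<in> E - A}"
      using W by (intro arg_cong2[where f = times] arg_cong2[where f = measure] refl) auto
    also have "\<dots> \<le> measure M' {\<omega>\<in>space M'. Z n \<omega> \<in> f ` (E - A)}"
      by (rule le) auto
    also have "\<dots> \<le> measure M' {\<omega>\<in>space M'. Z n \<omega> \<notin> A'}"
      by (rule finite_measure_mono[OF _ measurable_count_space_Collect[OF Z]]) (auto simp: A_def)
    finally have "c * measure M {\<omega>\<in>space M. W n \<omega> \<notin> A} \<le> c * \<delta>"
      using A' by simp
    then have "measure M {\<omega>\<in>space M. W n \<omega> \<notin> A} \<le> \<delta>"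
      using \<open>c > 0\<close> by simp
    moreover have "real (card A) \<le> exp (real n * (a + \<epsilon>))"
      using A A' by linarith
    ultimately show ?case
      using A by blast
  qed
next
  fix \<epsilon> d :: real assume "\<epsilon> > 0" "d > 0"
  then have "c * d > 0"
    using \<open>c > 0\<close> by simp
  show "\<forall>\<^sub>F n in sequentially. \<forall>A. finite A \<longrightarrow>
      d \<le> measure M {\<omega>\<in>space M. W n \<omega> \<in> A} \<longrightarrow> exp (real n * (a - \<epsilon>)) \<le> real (card A)"
    using covering_rate_lowerD[OF cov \<open>\<epsilon> > 0\<close> \<open>c * d > 0\<close>]
  proof eventually_elim
    case (elim n)
    show ?case
    proof (intro allI impI)
      fix A assume A: "finite A" "d \<le> measure M {\<omega>\<in>space M. W n \<omega> \<in> A}"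
      have "c * d \<le> c * measure M {\<omega>\<in>space M. W n \<omega> \<in> A}"
        using A \<open>c > 0\<close> by simp
      also have "\<dots> = c * measure M {\<omega>\<in>space M. W n \<omega> \<in> A \<inter> E}"
        using W by (intro arg_cong2[where f = times] arg_cong2[where f = measure] refl) auto
      also have "\<dots> \<le> measure M' {\<omega>\<in>space M'. Z n \<omega> \<in> f ` (A \<inter> E)}"
        by (rule le) auto
      finally have "exp (real n * (a - \<epsilon>)) \<le> real (card (f ` (A \<inter> E)))"
        using elim A by simp
      also have "card (f ` (A \<inter> E)) \<le> card A"
        using A by (meson card_image_le card_mono finite_Int inf_le1 order_trans)
      finally show "exp (real n * (a - \<epsilon>)) \<le> real (card A)"
        by simp
    qed
  qed
qed

text \<open>Projecting a covering does not enlarge it. Conversely, \<open>A \<times> R\<close>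
  catches all coloured points above A at the cost of the constant factor \<open>card R\<close>,
  which is eventually below exp (n \<epsilon> / 2).\<close>

lemma covering_rate_fst:
  fixes W :: "nat \<Rightarrow> 'w \<Rightarrow> 'a \<times> 'c"
  assumes cov: "covering_rate M W a" and "finite_measure M" and "finite R"
    and W: "\<And>n. W n \<in> measurable M (count_space (E \<times> R))"
  shows "covering_rate M (\<lambda>n \<omega>. fst (W n \<omega>)) a"
proof (rule covering_rateI)
  interpret finite_measure M by fact
  fix \<epsilon> \<delta> :: real assume "\<epsilon> > 0" "\<delta> > 0"
  show "\<forall>\<^sub>F n in sequentially. \<exists>A. finite A \<and>
      real (card A) \<le> exp (real n * (a + \<epsilon>)) \<and> measure M {\<omega>\<in>space M. fst (W n \<omega>) \<notin> A} \<le> \<delta>"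
    using covering_rate_upperD[OF cov \<open>\<epsilon> > 0\<close> \<open>\<delta> > 0\<close>]
  proof eventually_elim
    case (elim n)
    then obtain A where A: "finite A" "real (card A) \<le> exp (real n * (a + \<epsilon>))"
      "measure M {\<omega>\<in>space M. W n \<omega> \<notin> A} \<le> \<delta>"
      by blast
    have "measure M {\<omega>\<in>space M. fst (W n \<omega>) \<notin> fst ` A} \<le> measure M {\<omega>\<in>space M. W n \<omega> \<notin> A}"
      by (rule finite_measure_mono[OF _ measurable_count_space_Collect[OF W]]) auto
    moreover have "card (fst ` A) \<le> card A"
      using A by (intro card_image_le)
    ultimately show ?case
      using A by (intro exI[of _ "fst ` A"]) auto
  qed
next
  interpret finite_measure M by fact
  fix \<epsilon> c :: real assume "\<epsilon> > 0" "c > 0"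
  then have "\<epsilon> / 2 > 0" by simp
  have "\<forall>\<^sub>F n in sequentially. real (card R) \<le> exp (real n * (\<epsilon> / 2))"
    using \<open>\<epsilon> > 0\<close> by real_asymp
  with covering_rate_lowerD[OF cov \<open>\<epsilon> / 2 > 0\<close> \<open>c > 0\<close>]
  show "\<forall>\<^sub>F n in sequentially. \<forall>A. finite A \<longrightarrow>
      c \<le> measure M {\<omega>\<in>space M. fst (W n \<omega>) \<in> A} \<longrightarrow> exp (real n * (a - \<epsilon>)) \<le> real (card A)"
  proof eventually_elim
    case (elim n)
    show ?case
    proof (intro allI impI)
      fix A assume A: "finite A" "c \<le> measure M {\<omega>\<in>space M. fst (W n \<omega>) \<in> A}"
      have "W n \<omega> \<in> E \<times> R" if "\<omega> \<in> space M" for \<omega>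
        using measurable_space[OF W that] by simp
      then have "{\<omega>\<in>space M. fst (W n \<omega>) \<in> A} = {\<omega>\<in>space M. W n \<omega> \<in> A \<times> R}"
        by (auto simp: mem_Times_iff)
      then have "exp (real n * (a - \<epsilon> / 2)) \<le> real (card (A \<times> R))"
        using elim(1) A \<open>finite R\<close> by (metis finite_cartesian_product)
      also have "\<dots> = real (card A) * real (card R)"
        by (simp add: card_cartesian_product)
      also have "\<dots> \<le> real (card A) * exp (real n * (\<epsilon> / 2))"
        using elim(2) by (intro mult_left_mono) auto
      finally have "exp (real n * (a - \<epsilon> / 2)) / exp (real n * (\<epsilon> / 2)) \<le> real (card A)"
        by (simp add: divide_le_eq)
      also have "exp (real n * (a - \<epsilon> / 2)) / exp (real n * (\<epsilon> / 2)) = exp (real n * (a - \<epsilon>))"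
        unfolding exp_diff[symmetric] by (simp add: algebra_simps)
      finally show "exp (real n * (a - \<epsilon>)) \<le> real (card A)" .
    qed
  qed
qed

text \<open>Replacing each point of a covering for U by its neighbourhood of size k = \<eta> n gives
  a set that V hits with probability at least 1/2. The number of points grows by at most L ^ k, that
  is, by a rate \<eta> ln L that can be made arbitrarily small.\<close>

lemma (in prob_space) covering_rate_le_nearby:
  fixes nb :: "nat \<Rightarrow> 's \<Rightarrow> 's set"
  assumes U: "covering_rate M U a" and V: "covering_rate M V b" and "L \<ge> 1"
    and nb: "\<And>k x. finite (nb k x)" "\<And>k x. real (card (nb k x)) \<le> L ^ k"
    and U_sets: "\<And>n B. {\<omega>\<in>space M. U n \<omega> \<in> B} \<in> events"
    and V_sets: "\<And>n B. {\<omega>\<in>space M. V n \<omega> \<in> B} \<in> events"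
    and near_sets: "\<And>k n. {\<omega>\<in>space M. V n \<omega> \<notin> nb k (U n \<omega>)} \<in> events"
    and near: "\<And>\<eta>. \<eta> > 0 \<Longrightarrow>
      (\<lambda>n. prob {\<omega>\<in>space M. V n \<omega> \<notin> nb (nat \<lfloor>\<eta> * real n\<rfloor>) (U n \<omega>)}) \<longlonglongrightarrow> 0"
  shows "b \<le> a"
proof (rule field_le_epsilon)
  fix e :: real assume "e > 0"
  \<comment> \<open>One third of e pays for the thickening, the other two for the errors in the two
    covering rates. The added 1 avoids a division by 0 when L = 1.\<close>
  define \<eta> where "\<eta> = e / (3 * (1 + ln L))"
  have "ln L \<ge> 0"
    using \<open>L \<ge> 1\<close> by simp
  then have "\<eta> > 0" "\<eta> * ln L \<le> e / 3"
    using \<open>e > 0\<close> by (auto simp: \<eta>_def field_simps intro!: mult_pos_pos add_pos_nonneg)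
  have "e / 3 > 0" using \<open>e > 0\<close> by simp
  have "\<forall>\<^sub>F n in sequentially. prob {\<omega>\<in>space M. V n \<omega> \<notin> nb (nat \<lfloor>\<eta> * real n\<rfloor>) (U n \<omega>)} < 1 / 4"
    using near[OF \<open>\<eta> > 0\<close>] by (rule order_tendstoD(2)) simp
  moreover have "\<forall>\<^sub>F n in sequentially. \<exists>A. finite A \<and> real (card A) \<le> exp (real n * (a + e / 3)) \<and>
      prob {\<omega>\<in>space M. U n \<omega> \<notin> A} \<le> 1 / 4"
    using U \<open>e / 3 > 0\<close> by (rule covering_rate_upperD) simp
  moreover have "\<forall>\<^sub>F n in sequentially. \<forall>A. finite A \<longrightarrow>
      1 / 2 \<le> prob {\<omega>\<in>space M. V n \<omega> \<in> A} \<longrightarrow> exp (real n * (b - e / 3)) \<le> real (card A)"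
    using V \<open>e / 3 > 0\<close> by (rule covering_rate_lowerD) simp
  ultimately have "\<forall>\<^sub>F n in sequentially. b \<le> a + e"
    using eventually_gt_at_top[of 0]
  proof eventually_elim
    case (elim n)
    then obtain A where A: "finite A" "real (card A) \<le> exp (real n * (a + e / 3))"
      "prob {\<omega>\<in>space M. U n \<omega> \<notin> A} \<le> 1 / 4"
      by blast
    define k where "k = nat \<lfloor>\<eta> * real n\<rfloor>"
    have "real k \<le> \<eta> * real n"
      using \<open>\<eta> > 0\<close> by (simp add: k_def)
    define B where "B = (\<Union>x\<in>A. nb k x)"
    \<comment> \<open>If V n misses B, then U n misses A or V n lies outside the neighbourhood of U
      n; each event has probability at most 1/4.\<close>
    have "1 - prob {\<omega>\<in>space M. V n \<omega> \<in> B} = prob (space M - {\<omega>\<in>space M. V n \<omega> \<in> B})"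
      by (rule prob_compl[symmetric]) (rule V_sets)
    also have "\<dots> \<le> prob {\<omega>\<in>space M. U n \<omega> \<notin> A} + prob {\<omega>\<in>space M. V n \<omega> \<notin> nb k (U n \<omega>)}"
      using U_sets[of n "- A", unfolded Compl_iff] near_sets
      by (rule measure_le_add[rotated]) (auto simp: B_def)
    finally have "1 / 2 \<le> prob {\<omega>\<in>space M. V n \<omega> \<in> B}"
      using A elim(1) by (simp add: k_def)
    then have "exp (real n * (b - e / 3)) \<le> real (card B)"
      using elim(3) A nb(1) by (auto simp: B_def)
    also have "\<dots> \<le> (\<Sum>x\<in>A. real (card (nb k x)))"
      using card_UN_le[OF A(1), of "nb k"] unfolding B_def by (metis of_nat_le_iff of_nat_sum)
    also have "\<dots> \<le> real (card A) * L ^ k"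
      using nb(2) by (rule sum_bounded_above)
    also have "\<dots> \<le> exp (real n * (a + e / 3)) * exp (real n * (e / 3))"
    proof (intro mult_mono A)
      have "L ^ k = exp (real k * ln L)"
        using \<open>L \<ge> 1\<close> by (simp add: exp_of_nat_mult)
      also have "real k * ln L \<le> real n * (\<eta> * ln L)"
        using mult_right_mono[OF \<open>real k \<le> \<eta> * real n\<close> \<open>ln L \<ge> 0\<close>] by (simp add: mult_ac)
      also have "\<dots> \<le> real n * (e / 3)"
        using \<open>\<eta> * ln L \<le> e / 3\<close> by (rule mult_left_mono) simp
      finally show "L ^ k \<le> exp (real n * (e / 3))" by simp
    qed (use \<open>L \<ge> 1\<close> in auto)
    also have "\<dots> = exp (real n * (a + e / 3 + e / 3))"
      by (simp add: exp_add[symmetric] algebra_simps)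
    finally have "real n * (b - e / 3) \<le> real n * (a + e / 3 + e / 3)"
      by simp
    then have "b - e / 3 \<le> a + e / 3 + e / 3"
      using elim(4) by (simp only: mult_le_cancel_left_pos of_nat_0_less_iff)
    then show ?case by simp
  qed
  then show "b \<le> a + e" by simp
qed

section \<open>Word metric and translations of coloured walks\<close>

locale word_metric_group = group G for G :: "('a, 'b) monoid_scheme" (structure) +
  fixes S :: "'a set"
  assumes finite_S: "finite S" and S_subset: "S \<subseteq> carrier G"
    and generate_S: "generate G S = carrier G" and inv_S: "s \<in> S \<Longrightarrow> inv s \<in> S"
begin

abbreviation word_prod :: "'a list \<Rightarrow> 'a" where
  "word_prod ss \<equiv> foldr (\<otimes>) ss \<one>"

abbreviation wlen :: "'a \<Rightarrow> nat" where
  "wlen \<equiv> word_length G S"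

lemma word_prod_closed: "set ss \<subseteq> carrier G \<Longrightarrow> word_prod ss \<in> carrier G"
  by (induction ss) auto

lemma word_prod_append:
  "set ss \<subseteq> carrier G \<Longrightarrow> set ts \<subseteq> carrier G \<Longrightarrow> word_prod (ss @ ts) = word_prod ss \<otimes> word_prod ts"
  by (induction ss) (auto simp: m_assoc word_prod_closed)

lemma word_prod_rev_inv:
  "set ss \<subseteq> carrier G \<Longrightarrow> word_prod (rev (map (\<lambda>s. inv s) ss)) = inv (word_prod ss)"
proof (induction ss)
  case (Cons s ss)
  then have "set (rev (map (\<lambda>s. inv s) ss)) \<subseteq> carrier G"
    by auto
  then show ?case
    using Cons word_prod_append[of "rev (map (\<lambda>s. inv s) ss)" "[inv s]"]
    by (simp add: inv_mult_group word_prod_closed)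
qed simp

lemma word_prod_replicate_one: "word_prod (replicate n \<one>) = \<one>"
  by (induction n) auto

text \<open>Symmetry of S turns the inverses allowed by \<open>generate\<close> into letters. Hence
  the \<open>LEAST\<close> in \<open>word_length\<close> is taken over a nonempty set.\<close>

lemma ex_word: "g \<in> carrier G \<Longrightarrow> \<exists>ss. set ss \<subseteq> S \<and> g = word_prod ss"
  unfolding generate_S[symmetric]
proof (induction rule: generate.induct)
  case one
  then show ?case by (intro exI[of _ "[]"]) auto
next
  case (incl h)
  then show ?case using S_subset by (intro exI[of _ "[h]"]) auto
next
  case (inv h)
  then show ?case using S_subset inv_S[of h] by (intro exI[of _ "[inv h]"]) auto
next
  case (eng g h)
  then obtain ss ts where "set ss \<subseteq> S" "g = word_prod ss" "set ts \<subseteq> S" "h = word_prod ts"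
    by blast
  then show ?case
    using S_subset word_prod_append[of ss ts] by (intro exI[of _ "ss @ ts"]) auto
qed

lemma countable_carrier: "countable (carrier G)"
proof (rule countable_subset)
  show "carrier G \<subseteq> word_prod ` lists S"
    using ex_word by (fastforce simp: lists_eq_set)
  show "countable (word_prod ` lists S)"
    using finite_S by (intro countable_image countable_lists countable_finite)
qed

lemma wlen_le: "set ss \<subseteq> S \<Longrightarrow> wlen (word_prod ss) \<le> length ss"
  unfolding word_length_def by (rule Least_le) blast

lemma geodesic_word:
  assumes "g \<in> carrier G"
  obtains ss where "set ss \<subseteq> S" "g = word_prod ss" "length ss = wlen g"
proof -
  have "\<exists>k. \<exists>ss. length ss = k \<and> set ss \<subseteq> S \<and> g = word_prod ss"
    using ex_word[OF assms] by blast
  then have "\<exists>ss. length ss = wlen g \<and> set ss \<subseteq> S \<and> g = word_prod ss"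
    unfolding word_length_def by (rule LeastI_ex)
  then show thesis using that by blast
qed

lemma wlen_one: "wlen \<one> = 0"
  using wlen_le[of "[]"] by simp

lemma wlen_generator: "s \<in> S \<Longrightarrow> wlen s \<le> 1"
  using wlen_le[of "[s]"] S_subset by auto

lemma wlen_mult:
  assumes "g \<in> carrier G" "h \<in> carrier G"
  shows "wlen (g \<otimes> h) \<le> wlen g + wlen h"
proof -
  obtain ss ts where "set ss \<subseteq> S" "g = word_prod ss" "length ss = wlen g"
    and "set ts \<subseteq> S" "h = word_prod ts" "length ts = wlen h"
    using assms geodesic_word by metis
  then show ?thesis
    using wlen_le[of "ss @ ts"] word_prod_append[of ss ts] S_subset by auto
qed

lemma wlen_inv_le: "g \<in> carrier G \<Longrightarrow> wlen (inv g) \<le> wlen g"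
proof -
  assume "g \<in> carrier G"
  then obtain ss where ss: "set ss \<subseteq> S" "g = word_prod ss" "length ss = wlen g"
    by (rule geodesic_word)
  then have "set (rev (map (\<lambda>s. inv s) ss)) \<subseteq> S"
    using inv_S by auto
  then show ?thesis
    using wlen_le[of "rev (map (\<lambda>s. inv s) ss)"] word_prod_rev_inv[of ss] ss S_subset by auto
qed

lemma wlen_inv: "g \<in> carrier G \<Longrightarrow> wlen (inv g) = wlen g"
  using wlen_inv_le[of g] wlen_inv_le[of "inv g"] by simp

lemma inv_mult_mult_cancel:
  assumes "x \<in> carrier G" "y \<in> carrier G" "z \<in> carrier G"
  shows "(inv x \<otimes> y) \<otimes> (inv y \<otimes> z) = inv x \<otimes> z"
proof -
  have "(inv x \<otimes> y) \<otimes> (inv y \<otimes> z) = inv x \<otimes> (y \<otimes> (inv y \<otimes> z))"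
    using assms by (intro m_assoc) auto
  also have "y \<otimes> (inv y \<otimes> z) = z"
    using assms by (simp flip: m_assoc)
  finally show ?thesis .
qed

lemma wlen_le_add_dist:
  assumes "x \<in> carrier G" "y \<in> carrier G"
  shows "wlen y \<le> wlen x + wlen (inv x \<otimes> y)"
  using wlen_mult[of x "inv x \<otimes> y"] assms by (simp flip: m_assoc)

lemma wlen_dist_commute:
  assumes "x \<in> carrier G" "y \<in> carrier G"
  shows "wlen (inv x \<otimes> y) = wlen (inv y \<otimes> x)"
  using wlen_inv[of "inv x \<otimes> y"] assms by (simp add: inv_mult_group)

lemma abs_wlen_diff_le:
  assumes "x \<in> carrier G" "y \<in> carrier G"
  shows "\<bar>real (wlen x) - real (wlen y)\<bar> \<le> real (wlen (inv x \<otimes> y))"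
  using wlen_le_add_dist[OF assms] wlen_le_add_dist[OF assms(2,1)] wlen_dist_commute[OF assms] by linarith

text \<open>The increments multiply up along the path, so the triangle inequality applies. Both
  orders of i and j are treated, since a random time may fall on either side of the deterministic
  one with which it is compared.\<close>

lemma wlen_path_le:
  assumes y: "\<And>n. y n \<in> carrier G" and step: "\<And>n. wlen (inv (y n) \<otimes> y (Suc n)) \<le> 1"
  shows "real (wlen (inv (y i) \<otimes> y j)) \<le> \<bar>real i - real j\<bar>"
proof -
  have le: "wlen (inv (y i) \<otimes> y (i + d)) \<le> d" for i d
  proof (induction d)
    case 0
    then show ?case using y by (simp add: wlen_one)
  next
    case (Suc d)
    have "inv (y i) \<otimes> y (i + Suc d) = (inv (y i) \<otimes> y (i + d)) \<otimes> (inv (y (i + d)) \<otimes> y (Suc (i + d)))"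
      using y by (simp add: inv_mult_mult_cancel)
    also have "wlen \<dots> \<le> wlen (inv (y i) \<otimes> y (i + d)) + wlen (inv (y (i + d)) \<otimes> y (Suc (i + d)))"
      using y by (intro wlen_mult) auto
    finally show ?case using Suc step[of "i + d"] by simp
  qed
  show ?thesis
  proof (cases "i \<le> j")
    case True
    then show ?thesis using le[of i "j - i"] by simp
  next
    case False
    then show ?thesis using le[of j "i - j"] wlen_dist_commute[OF y y, of i j] by simp
  qed
qed

section \<open>Growth of balls in the word metric\<close>

definition word_ball :: "nat \<Rightarrow> 'a set" where
  "word_ball k = {g \<in> carrier G. wlen g \<le> k}"

text \<open>Padding a geodesic word with the identity gives it length exactly k. One power of
  \<open>card S + 1\<close> then bounds the ball, instead of a sum over all lengths up to k.\<close>

lemma word_ball_subset: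
  "word_ball k \<subseteq> word_prod ` {ss. set ss \<subseteq> insert \<one> S \<and> length ss = k}"
proof
  fix g assume "g \<in> word_ball k"
  then have "g \<in> carrier G" "wlen g \<le> k"
    by (auto simp: word_ball_def)
  then obtain ss where ss: "set ss \<subseteq> S" "g = word_prod ss" "length ss = wlen g"
    using geodesic_word by metis
  let ?ts = "ss @ replicate (k - wlen g) \<one>"
  have "word_prod ?ts = g"
  proof -
    have "word_prod ?ts = word_prod ss \<otimes> word_prod (replicate (k - wlen g) \<one>)"
      using ss S_subset by (intro word_prod_append) auto
    then show ?thesis
      using ss \<open>g \<in> carrier G\<close> unfolding word_prod_replicate_one by simp
  qed
  moreover have "set ?ts \<subseteq> insert \<one> S" "length ?ts = k"
    using ss \<open>wlen g \<le> k\<close> by auto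
  ultimately show "g \<in> word_prod ` {ss. set ss \<subseteq> insert \<one> S \<and> length ss = k}"
    by (intro image_eqI[of _ _ ?ts]) auto
qed

lemma finite_words: "finite {ss. set ss \<subseteq> insert \<one> S \<and> length ss = k}"
  using finite_S by (intro finite_lists_length_eq) auto

lemma finite_word_ball: "finite (word_ball k)"
  by (rule finite_subset[OF word_ball_subset finite_imageI[OF finite_words]])

lemma card_word_ball_le: "card (word_ball k) \<le> (card S + 1) ^ k"
proof -
  have "card (word_ball k) \<le> card (word_prod ` {ss. set ss \<subseteq> insert \<one> S \<and> length ss = k})"
    by (rule card_mono[OF finite_imageI[OF finite_words] word_ball_subset])
  also have "\<dots> \<le> card {ss. set ss \<subseteq> insert \<one> S \<and> length ss = k}"
    by (rule card_image_le[OF finite_words])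
  also have "\<dots> = card (insert \<one> S) ^ k"
    using finite_S by (intro card_lists_length_eq) auto
  also have "\<dots> \<le> (card S + 1) ^ k"
    using finite_S by (intro power_mono) (auto simp: card_insert_if)
  finally show ?thesis .
qed

end

section \<open>Left translations and the change of the initial colour\<close>

definition translate :: "('a, 'b) monoid_scheme \<Rightarrow> 'a \<Rightarrow> 'a \<times> 'c \<Rightarrow> 'a \<times> 'c" where
  "translate G g z = (g \<otimes>\<^bsub>G\<^esub> fst z, snd z)"

context group
begin

lemma bij_betw_translate:
  assumes "g \<in> carrier G"
  shows "bij_betw (translate G g) (carrier G \<times> R) (carrier G \<times> R)"
proof (rule bij_betw_byWitness[where f' = "translate G (inv g)"])
  show "\<forall>z\<in>carrier G \<times> R. translate G (inv g) (translate G g z) = z"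
    and "\<forall>z\<in>carrier G \<times> R. translate G g (translate G (inv g) z) = z"
    using assms by (auto simp: translate_def simp flip: m_assoc)
qed (use assms in \<open>auto simp: translate_def\<close>)

text \<open>The kernel depends on the group coordinates only through the right increment, in which a
  common left factor cancels.\<close>

lemma coloured_kernel_translate:
  assumes "g \<in> carrier G" "fst z \<in> carrier G" "fst y \<in> carrier G"
  shows "coloured_kernel G pt (translate G g z) (translate G g y) = coloured_kernel G pt z y"
proof -
  have "inv (g \<otimes> fst z) \<otimes> (g \<otimes> fst y) = inv (fst z) \<otimes> (inv g \<otimes> (g \<otimes> fst y))"
    using assms by (simp add: inv_mult_group m_assoc)
  also have "inv g \<otimes> (g \<otimes> fst y) = fst y"
    using assms by (simp flip: m_assoc)
  finally show ?thesis
    by (simp add: coloured_kernel_def translate_def)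
qed

end

locale coloured_walk_group = group G for G :: "('a, 'b) monoid_scheme" (structure) +
  fixes r :: nat and pt :: "'a \<Rightarrow> nat \<Rightarrow> nat \<Rightarrow> real"
  assumes step: "coloured_step G r pt" and countable_group: "countable (carrier G)"
begin

lemma countable_coloured_states: "countable (coloured_states G r)"
  using countable_group by (simp add: coloured_states_def)

lemma coloured_kernel_nonneg:
  assumes "z \<in> coloured_states G r" "y \<in> coloured_states G r"
  shows "coloured_kernel G pt z y \<ge> 0"
  using assms step unfolding coloured_step_def coloured_kernel_def coloured_states_def by auto

lemma coloured_walk_chain:
  "coloured_walk G r pt u M Y \<Longrightarrow>
    countable_markov_chain M (coloured_states G r) (coloured_kernel G pt) (\<one>, u) Y"
  unfolding coloured_walk_def by (rule countable_markov_chain.intro[OF _ countable_coloured_states])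

text \<open>Chapman-Kolmogorov with a single intermediate state: go from (\<one>, u) to (g, v) in k
  steps, then follow the left translate by g of a path that starts at (\<one>, v). The two walks
  serve to make the sums defining the kernel powers from v and from u converge.\<close>

lemma kernel_power_translate_le:
  assumes Y: "coloured_walk G r pt v M Y" and Y': "coloured_walk G r pt u M' Y'"
    and g: "g \<in> carrier G" "v \<in> {1..r}" and "y \<in> coloured_states G r"
  shows "kernel_power (coloured_states G r) (coloured_kernel G pt) k (\<one>, u) (g, v)
      * kernel_power (coloured_states G r) (coloured_kernel G pt) n (\<one>, v) y
    \<le> kernel_power (coloured_states G r) (coloured_kernel G pt) (k + n) (\<one>, u) (translate G g y)"
  using \<open>y \<in> coloured_states G r\<close>
proof (induction n arbitrary: y)
  case 0
  interpret Y': countable_markov_chain M' "coloured_states G r" "coloured_kernel G pt" "(\<one>, u)" Y'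
    using Y' by (rule coloured_walk_chain)
  have "translate G g y \<in> coloured_states G r"
    using 0 g by (auto simp: translate_def coloured_states_def)
  then show ?case
    using g Y'.kernel_power_nonneg[of "translate G g y" k] by (auto simp: translate_def)
next
  case (Suc n)
  let ?E = "coloured_states G r" and ?K = "coloured_kernel G pt"
  interpret Y: countable_markov_chain M ?E ?K "(\<one>, v)" Y
    using Y by (rule coloured_walk_chain)
  interpret Y': countable_markov_chain M' ?E ?K "(\<one>, u)" Y'
    using Y' by (rule coloured_walk_chain)
  have T: "bij_betw (translate G g) ?E ?E"
    using bij_betw_translate[OF g(1)] by (simp add: coloured_states_def)
  then have Ty: "translate G g y \<in> ?E"
    using Suc.prems by (auto simp: bij_betw_def)
  \<comment> \<open>Translation permutes the states; after reindexing, both sums run over the same z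
    and can be compared term by term.\<close>
  have translated: "((\<lambda>z. kernel_power ?E ?K (k + n) (\<one>, u) (translate G g z) * ?K (translate G g z) (translate G g y))
      has_sum kernel_power ?E ?K (Suc (k + n)) (\<one>, u) (translate G g y)) ?E"
    using Y'.has_sum_kernel_power_step[OF Ty, of "k + n"]
    by (simp only: has_sum_reindex_bij_betw[OF T, where
          f = "\<lambda>z. kernel_power ?E ?K (k + n) (\<one>, u) z * ?K z (translate G g y)"])
  have original: "((\<lambda>z. kernel_power ?E ?K k (\<one>, u) (g, v) * (kernel_power ?E ?K n (\<one>, v) z * ?K z y))
      has_sum kernel_power ?E ?K k (\<one>, u) (g, v) * kernel_power ?E ?K (Suc n) (\<one>, v) y) ?E"
    by (rule has_sum_cmult_right[OF Y.has_sum_kernel_power_step[OF Suc.prems]])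
  have "kernel_power ?E ?K k (\<one>, u) (g, v) * (kernel_power ?E ?K n (\<one>, v) z * ?K z y)
      \<le> kernel_power ?E ?K (k + n) (\<one>, u) (translate G g z) * ?K (translate G g z) (translate G g y)"
    if "z \<in> ?E" for z
  proof -
    have "?K (translate G g z) (translate G g y) = ?K z y"
      using g that Suc.prems by (intro coloured_kernel_translate) (auto simp: coloured_states_def)
    then show ?thesis
      using mult_right_mono[OF Suc.IH[OF that] coloured_kernel_nonneg[OF that Suc.prems]]
      by (simp only: mult.assoc)
  qed
  then have "kernel_power ?E ?K k (\<one>, u) (g, v) * kernel_power ?E ?K (Suc n) (\<one>, v) y
      \<le> kernel_power ?E ?K (Suc (k + n)) (\<one>, u) (translate G g y)"
    by (rule has_sum_mono[OF original translated])
  then show ?case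
    by (simp only: add_Suc_right)
qed

text \<open>The pointwise bound, summed over B, is the domination hypothesis of
  \<open>covering_rate_transfer\<close> and \<open>tendsto_in_prob_transfer\<close>.\<close>

lemma prob_translate_le:
  assumes Y: "coloured_walk G r pt v M Y" and Y': "coloured_walk G r pt u M' Y'"
    and g: "g \<in> carrier G" "v \<in> {1..r}" and B: "B \<subseteq> coloured_states G r"
  shows "kernel_power (coloured_states G r) (coloured_kernel G pt) k (\<one>, u) (g, v)
      * measure M {\<omega>\<in>space M. Y n \<omega> \<in> B}
    \<le> measure M' {\<omega>\<in>space M'. Y' (k + n) \<omega> \<in> translate G g ` B}"
proof -
  let ?E = "coloured_states G r" and ?K = "coloured_kernel G pt"
  interpret Y: countable_markov_chain M ?E ?K "(\<one>, v)" Y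
    using Y by (rule coloured_walk_chain)
  interpret Y': countable_markov_chain M' ?E ?K "(\<one>, u)" Y'
    using Y' by (rule coloured_walk_chain)
  have T: "bij_betw (translate G g) ?E ?E"
    using bij_betw_translate[OF g(1)] by (simp add: coloured_states_def)
  have TB: "inj_on (translate G g) B" "translate G g ` B \<subseteq> ?E"
    using T B by (auto simp: bij_betw_def intro: inj_on_subset)
  have TB_sum: "((\<lambda>z. kernel_power ?E ?K (k + n) (\<one>, u) (translate G g z)) has_sum
      measure M' {\<omega>\<in>space M'. Y' (k + n) \<omega> \<in> translate G g ` B}) B"
    using Y'.has_sum_kernel_power[OF TB(2), of "k + n"]
    unfolding has_sum_reindex[OF TB(1)] comp_def .
  show ?thesis
    using kernel_power_translate_le[OF Y Y' g] B
    by (intro has_sum_mono[OF has_sum_cmult_right[OF Y.has_sum_kernel_power[OF B, of n]] TB_sum]) blast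
qed

lemma colour_matrix_nonneg:
  assumes "v \<in> {1..r}" "w \<in> {1..r}"
  shows "colour_matrix G pt v w \<ge> 0"
  using assms step unfolding colour_matrix_def coloured_step_def by (intro infsum_nonneg) auto

text \<open>\<open>quasi_irreducible\<close> speaks of the colour chain alone. A colour path of
  positive weight is lifted step by step: each positive entry of \<open>colour_matrix\<close> sums
  nonnegative entries, one of which must be positive and supplies the group increment.\<close>

lemma colour_kernel_power_pos_imp:
  assumes Y: "coloured_walk G r pt u M Y" and "v \<in> {1..r}"
    and "kernel_power {1..r} (colour_matrix G pt) n u v > 0"
  shows "\<exists>g\<in>carrier G. kernel_power (coloured_states G r) (coloured_kernel G pt) n (\<one>, u) (g, v) > 0"
  using assms(2,3)
proof (induction n arbitrary: v)
  case 0
  then show ?case by (intro bexI[of _ "\<one>"]) (auto split: if_splits)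
next
  case (Suc n)
  let ?E = "coloured_states G r" and ?K = "coloured_kernel G pt"
  interpret Y: countable_markov_chain M ?E ?K "(\<one>, u)" Y
    using Y by (rule coloured_walk_chain)
  have "(\<Sum>w\<in>{1..r}. kernel_power {1..r} (colour_matrix G pt) n u w * colour_matrix G pt w v) > 0"
    using Suc.prems by simp
  then obtain w where w: "w \<in> {1..r}"
    "kernel_power {1..r} (colour_matrix G pt) n u w * colour_matrix G pt w v > 0"
    by (meson linorder_not_le sum_nonpos)
  then have w_pos: "kernel_power {1..r} (colour_matrix G pt) n u w > 0" "colour_matrix G pt w v > 0"
    using colour_matrix_nonneg[OF w(1) Suc.prems(1)] by (auto simp: zero_less_mult_iff)
  obtain g where g: "g \<in> carrier G" "kernel_power ?E ?K n (\<one>, u) (g, w) > 0"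
    using Suc.IH[OF w(1) w_pos(1)] by blast
  obtain s where s: "s \<in> carrier G" "pt s w v \<noteq> 0"
    using w_pos(2) unfolding colour_matrix_def by (metis infsum_0 less_irrefl)
  have "pt s w v > 0"
    using s w(1) Suc.prems(1) step unfolding coloured_step_def by (metis order_less_le)
  have gs: "(g \<otimes> s, v) \<in> ?E" "(g, w) \<in> ?E"
    using g s w Suc.prems by (auto simp: coloured_states_def)
  have "?K (g, w) (g \<otimes> s, v) = pt s w v"
    using g s by (simp add: coloured_kernel_def flip: m_assoc)
  then have "0 < kernel_power ?E ?K n (\<one>, u) (g, w) * ?K (g, w) (g \<otimes> s, v)"
    using g \<open>pt s w v > 0\<close> by simp
  also have "\<dots> \<le> kernel_power ?E ?K (Suc n) (\<one>, u) (g \<otimes> s, v)"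
  \<comment> \<open>A single term, the one at (g, w), is a lower bound for the whole sum of
    nonnegative terms.\<close>
  proof (rule has_sum_mono'[OF _ Y.has_sum_kernel_power_step[OF gs(1)]])
    let ?f = "\<lambda>z. kernel_power ?E ?K n (\<one>, u) z * ?K z (g \<otimes> s, v)"
    show "(?f has_sum ?f (g, w)) {(g, w)}"
      using has_sum_finite[of "{(g, w)}" ?f] by simp
    show "0 \<le> ?f z" if "z \<in> ?E - {(g, w)}" for z
      using that Y.kernel_power_nonneg coloured_kernel_nonneg gs by (intro mult_nonneg_nonneg) auto
  qed (use gs in auto)
  finally show ?case
    using g s by (intro bexI[of _ "g \<otimes> s"]) auto
qed

end

section \<open>Limits along a random clock\<close>

definition tendsto_in_prob :: "'w measure \<Rightarrow> (nat \<Rightarrow> 'w \<Rightarrow> real) \<Rightarrow> real \<Rightarrow> bool" where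
  "tendsto_in_prob M R c \<longleftrightarrow> (\<forall>e>0. (\<lambda>n. measure M {\<omega>\<in>space M. e < \<bar>R n \<omega> - c\<bar>}) \<longlonglongrightarrow> 0)"

lemma tendsto_in_probD:
  "tendsto_in_prob M R c \<Longrightarrow> e > 0 \<Longrightarrow> (\<lambda>n. measure M {\<omega>\<in>space M. e < \<bar>R n \<omega> - c\<bar>}) \<longlonglongrightarrow> 0"
  by (simp add: tendsto_in_prob_def)

lemma tendsto_in_probI:
  assumes "\<And>e. e > 0 \<Longrightarrow> \<forall>\<^sub>F n in sequentially. measure M {\<omega>\<in>space M. e < \<bar>R n \<omega> - c\<bar>} \<le> q e n"
    and "\<And>e. e > 0 \<Longrightarrow> q e \<longlonglongrightarrow> 0"
  shows "tendsto_in_prob M R c"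
  unfolding tendsto_in_prob_def
proof (intro allI impI)
  fix e :: real assume "e > 0"
  show "(\<lambda>n. measure M {\<omega>\<in>space M. e < \<bar>R n \<omega> - c\<bar>}) \<longlonglongrightarrow> 0"
    by (rule tendsto_sandwich[OF _ assms(1)[OF \<open>e > 0\<close>] tendsto_const assms(2)[OF \<open>e > 0\<close>]]) simp
qed

lemma tendsto_in_prob_reindex:
  fixes L :: "nat \<Rightarrow> 'w \<Rightarrow> real"
  assumes lim: "tendsto_in_prob M (\<lambda>n \<omega>. L n \<omega> / real n) c"
    and "finite_measure M" and [measurable]: "\<And>n. L n \<in> borel_measurable M" and "m \<ge> 0"
    and j: "filterlim j at_top sequentially" "(\<lambda>n. real (j n) / real n) \<longlonglongrightarrow> m"
  shows "tendsto_in_prob M (\<lambda>n \<omega>. L (j n) \<omega> / real n) (m * c)"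
proof (rule tendsto_in_probI)
  interpret finite_measure M by fact
  fix e :: real assume "e > 0"
  \<comment> \<open>L (j n) / n is (L (j n) / j n) times j n / n. The second factor is eventually
    below m + 1, so an error e' in the first costs at most e / 2; the other e / 2 is left for the
    deviation of j n / n from m.\<close>
  define e' where "e' = e / (2 * (m + 1))"
  have e': "e' > 0" "e' * (m + 1) = e / 2"
    using \<open>e > 0\<close> \<open>m \<ge> 0\<close> by (auto simp: e'_def field_simps)
  show "(\<lambda>n. measure M {\<omega>\<in>space M. e' < \<bar>L (j n) \<omega> / real (j n) - c\<bar>}) \<longlonglongrightarrow> 0"
    by (rule filterlim_compose[OF tendsto_in_probD[OF lim e'(1)] j(1)])
  have "(\<lambda>n. \<bar>(real (j n) / real n - m) * c\<bar>) \<longlonglongrightarrow> \<bar>(m - m) * c\<bar>"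
    by (intro tendsto_intros j)
  then have "\<forall>\<^sub>F n in sequentially. \<bar>(real (j n) / real n - m) * c\<bar> < e / 2"
    using \<open>e > 0\<close> by (intro order_tendstoD(2)) auto
  moreover have "\<forall>\<^sub>F n in sequentially. real (j n) / real n < m + 1"
    using j(2) by (rule order_tendstoD(2)) simp
  moreover have "\<forall>\<^sub>F n in sequentially. j n \<ge> 1"
    using j(1) by (simp add: filterlim_at_top)
  ultimately show "\<forall>\<^sub>F n in sequentially. measure M {\<omega>\<in>space M. e < \<bar>L (j n) \<omega> / real n - m * c\<bar>}
      \<le> measure M {\<omega>\<in>space M. e' < \<bar>L (j n) \<omega> / real (j n) - c\<bar>}"
  proof eventually_elim
    case (elim n)
    have "\<bar>L (j n) \<omega> / real n - m * c\<bar> \<le> e" if "\<bar>L (j n) \<omega> / real (j n) - c\<bar> \<le> e'" for \<omega>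
    proof -
      have "L (j n) \<omega> / real n - m * c
          = (L (j n) \<omega> / real (j n) - c) * (real (j n) / real n) + (real (j n) / real n - m) * c"
        using elim(3) by (simp add: algebra_simps)
      then have "\<bar>L (j n) \<omega> / real n - m * c\<bar>
          \<le> \<bar>(L (j n) \<omega> / real (j n) - c) * (real (j n) / real n)\<bar> + \<bar>(real (j n) / real n - m) * c\<bar>"
        by (simp only: abs_triangle_ineq)
      also have "\<dots> \<le> e' * (m + 1) + e / 2"
      proof (rule add_mono)
        show "\<bar>(L (j n) \<omega> / real (j n) - c) * (real (j n) / real n)\<bar> \<le> e' * (m + 1)"
          unfolding abs_mult using that elim e' by (intro mult_mono) auto
      qed (use elim(1) in simp)
      finally show ?thesis
        using e'(2) by simp
    qed
    then show ?case
      by (intro finite_measure_mono) (force simp: not_le[symmetric], measurable)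
  qed
qed

text \<open>A bounded change D of the length is invisible after division by n, and the factor 1 / d
  does not affect convergence of probabilities to 0.\<close>

lemma tendsto_in_prob_transfer:
  fixes \<l>' :: "'s \<Rightarrow> real" and \<l> :: "'t \<Rightarrow> real"
  assumes lim: "tendsto_in_prob M' (\<lambda>n \<omega>. \<l>' (Z n \<omega>) / real n) c" and "finite_measure M'" and "d > 0"
    and Z: "\<And>n. Z n \<in> measurable M' (count_space E')"
    and W: "\<And>n \<omega>. \<omega> \<in> space M \<Longrightarrow> W n \<omega> \<in> E"
    and le: "\<And>n B. B \<subseteq> E \<Longrightarrow>
      d * measure M {\<omega>\<in>space M. W n \<omega> \<in> B} \<le> measure M' {\<omega>\<in>space M'. Z n \<omega> \<in> f ` B}"
    and close: "\<And>x. x \<in> E \<Longrightarrow> \<bar>\<l>' (f x) - \<l> x\<bar> \<le> D"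
  shows "tendsto_in_prob M (\<lambda>n \<omega>. \<l> (W n \<omega>) / real n) c"
proof (rule tendsto_in_probI)
  interpret finite_measure M' by fact
  fix e :: real assume "e > 0"
  then have "(\<lambda>n. measure M' {\<omega>\<in>space M'. e / 2 < \<bar>\<l>' (Z n \<omega>) / real n - c\<bar>} / d) \<longlonglongrightarrow> 0 / d"
    using \<open>d > 0\<close> by (intro tendsto_divide tendsto_in_probD[OF lim] tendsto_const) auto
  then show "(\<lambda>n. measure M' {\<omega>\<in>space M'. e / 2 < \<bar>\<l>' (Z n \<omega>) / real n - c\<bar>} / d) \<longlonglongrightarrow> 0"
    by simp
  have "\<forall>\<^sub>F n in sequentially. D \<le> real n * (e / 2)"
    using \<open>e > 0\<close> by real_asymp
  then show "\<forall>\<^sub>F n in sequentially. measure M {\<omega>\<in>space M. e < \<bar>\<l> (W n \<omega>) / real n - c\<bar>}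
      \<le> measure M' {\<omega>\<in>space M'. e / 2 < \<bar>\<l>' (Z n \<omega>) / real n - c\<bar>} / d"
    using eventually_gt_at_top[of 0]
  proof eventually_elim
    case (elim n)
    define B where "B = {x\<in>E. e < \<bar>\<l> x / real n - c\<bar>}"
    have "e / 2 < \<bar>\<l>' (f x) / real n - c\<bar>" if "x \<in> B" for x
    proof -
      have "\<bar>\<l>' (f x) / real n - \<l> x / real n\<bar> = \<bar>\<l>' (f x) - \<l> x\<bar> / real n"
        by (simp flip: diff_divide_distrib)
      also have "\<dots> \<le> D / real n"
        using close that by (intro divide_right_mono) (auto simp: B_def)
      also have "\<dots> \<le> e / 2"
        using elim by (simp add: field_simps)
      finally have "\<bar>\<l>' (f x) / real n - \<l> x / real n\<bar> \<le> e / 2" .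
      moreover have "e < \<bar>\<l> x / real n - c\<bar>"
        using that by (simp add: B_def)
      ultimately show ?thesis
        by linarith
    qed
    then have sub: "{\<omega>\<in>space M'. Z n \<omega> \<in> f ` B} \<subseteq> {\<omega>\<in>space M'. e / 2 < \<bar>\<l>' (Z n \<omega>) / real n - c\<bar>}"
      by auto
    have "{\<omega>\<in>space M. e < \<bar>\<l> (W n \<omega>) / real n - c\<bar>} = {\<omega>\<in>space M. W n \<omega> \<in> B}"
      using W by (auto simp: B_def)
    then have "d * measure M {\<omega>\<in>space M. e < \<bar>\<l> (W n \<omega>) / real n - c\<bar>}
        \<le> measure M' {\<omega>\<in>space M'. Z n \<omega> \<in> f ` B}"
      using le[of B n] by (simp add: B_def)
    also have "\<dots> \<le> measure M' {\<omega>\<in>space M'. e / 2 < \<bar>\<l>' (Z n \<omega>) / real n - c\<bar>}"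
      by (rule finite_measure_mono[OF sub measurable_count_space_Collect[OF Z]])
    finally show ?case
      using \<open>d > 0\<close> by (simp add: field_simps)
  qed
qed

lemma (in prob_space) tendsto_in_prob_unique:
  assumes R: "tendsto_in_prob M R a" "tendsto_in_prob M R' b" "tendsto_in_prob M \<Delta> 0"
    and [measurable]: "\<And>n. R n \<in> borel_measurable M" "\<And>n. R' n \<in> borel_measurable M"
      "\<And>n. \<Delta> n \<in> borel_measurable M"
    and close: "AE \<omega> in M. \<forall>n. \<bar>R n \<omega> - R' n \<omega>\<bar> \<le> \<bar>\<Delta> n \<omega>\<bar>"
  shows "a = b"
proof (rule ccontr)
  assume "a \<noteq> b"
  \<comment> \<open>If all three deviations were at most e, then a and b would be within 3 * e of
    each other. So the three events cover the space, although each eventually has probability below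
    1/4.\<close>
  define e where "e = \<bar>a - b\<bar> / 4"
  have "e > 0"
    using \<open>a \<noteq> b\<close> by (simp add: e_def)
  let ?A = "\<lambda>R c n. {\<omega>\<in>space M. e < \<bar>R n \<omega> - c\<bar>}"
  have ev: "\<forall>\<^sub>F n in sequentially. prob (?A R c n) < 1 / 4" if "tendsto_in_prob M R c" for R c
    using tendsto_in_probD[OF that \<open>e > 0\<close>] by (rule order_tendstoD(2)) simp
  have "\<forall>\<^sub>F n in sequentially. False"
    using ev[OF R(1)] ev[OF R(2)] ev[OF R(3)]
  proof eventually_elim
    case (elim n)
    have "prob (space M) \<le> prob (?A R a n \<union> (?A R' b n \<union> ?A \<Delta> 0 n))"
    proof (rule finite_measure_mono_AE)
      show "AE \<omega> in M. \<omega> \<in> space M \<longrightarrow> \<omega> \<in> ?A R a n \<union> (?A R' b n \<union> ?A \<Delta> 0 n)"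
        using close
      proof eventually_elim
        case (elim \<omega>)
        then have "\<bar>R n \<omega> - R' n \<omega>\<bar> \<le> \<bar>\<Delta> n \<omega>\<bar>" by blast
        moreover have "\<bar>a - b\<bar> = 4 * e" by (simp add: e_def)
        ultimately have "e < \<bar>R n \<omega> - a\<bar> \<or> e < \<bar>R' n \<omega> - b\<bar> \<or> e < \<bar>\<Delta> n \<omega> - 0\<bar>"
          using \<open>e > 0\<close> by linarith
        then show ?case by blast
      qed
    qed measurable
    also have "\<dots> \<le> prob (?A R a n) + prob (?A R' b n \<union> ?A \<Delta> 0 n)"
      by (intro measure_Un_le) measurable
    also have "prob (?A R' b n \<union> ?A \<Delta> 0 n) \<le> prob (?A R' b n) + prob (?A \<Delta> 0 n)"
      by (intro measure_Un_le) measurable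
    finally show ?case
      using elim prob_space by linarith
  qed
  then show False by simp
qed

text \<open>The natural filtration consists of sub-sigma-algebras of M, so T is measurable for M. As
  the Borel sets of \<open>enat\<close> are all its subsets, composing with \<open>the_enat\<close>
  is harmless, whatever its value at infinity.\<close>

lemma borel_measurable_the_enat_natural_stopping_time:
  assumes Z: "\<And>i. Z i \<in> measurable M (count_space E)"
    and T: "stopping_time (natural_filtration M Z) T"
  shows "(\<lambda>\<omega>. real (the_enat (T \<omega>))) \<in> borel_measurable M"
proof -
  have "{Z i -` A \<inter> space M |i A. enat i \<le> t} \<subseteq> sets M" for t
  proof (clarify)
    fix i A assume "enat i \<le> t"
    have "{\<omega>\<in>space M. Z i \<omega> \<in> A} \<in> sets M"
      using Z by (rule measurable_count_space_Collect)
    also have "{\<omega>\<in>space M. Z i \<omega> \<in> A} = Z i -` A \<inter> space M"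
      by auto
    finally show "Z i -` A \<inter> space M \<in> sets M" .
  qed
  then have "sets (natural_filtration M Z t) \<subseteq> sets M" for t
    unfolding natural_filtration_def
    by (subst sets_measure_of) (auto intro!: sets.sigma_sets_subset)
  moreover have "space (natural_filtration M Z t) = space M" for t
    unfolding natural_filtration_def by (rule space_measure_of_conv)
  ultimately have "T \<in> measurable M borel"
    using T by (intro measurable_stopping_time)
  moreover have "(\<lambda>t::enat. real (the_enat t)) \<in> measurable borel borel"
    by (simp add: measurable_cong_sets[OF sets_borel_eq_count_space refl])
  ultimately show ?thesis
    by (rule measurable_compose)
qed

text \<open>Fixing the value of U, which ranges over a countable set, turns a joint condition into
  conditions on V alone.\<close>

lemma sets_Collect_count_space2:
  assumes "countable E" "U \<in> measurable M (count_space E)" "V \<in> measurable M (count_space F)"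
  shows "{\<omega>\<in>space M. Q (U \<omega>) (V \<omega>)} \<in> sets M"
proof -
  have "{\<omega>\<in>space M. U \<omega> = x} \<inter> {\<omega>\<in>space M. Q x (V \<omega>)} \<in> sets M" for x
    using measurable_count_space_Collect[OF assms(2)] measurable_count_space_Collect[OF assms(3)]
    by (rule sets.Int)
  then have "(\<Union>x\<in>E. {\<omega>\<in>space M. U \<omega> = x} \<inter> {\<omega>\<in>space M. Q x (V \<omega>)}) \<in> sets M"
    using assms(1) by (intro sets.countable_UN') auto
  also have "(\<Union>x\<in>E. {\<omega>\<in>space M. U \<omega> = x} \<inter> {\<omega>\<in>space M. Q x (V \<omega>)}) = {\<omega>\<in>space M. Q (U \<omega>) (V \<omega>)}"
    using measurable_space[OF assms(2)] by auto
  finally show ?thesis .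
qed

text \<open>The term \<open>sqrt (real n)\<close> diverges but is o(n), so it leaves the slope m
  unchanged.\<close>

lemma clock_limits:
  assumes "m \<ge> (0::real)"
  shows "filterlim (\<lambda>n. nat \<lfloor>m * real n + sqrt (real n)\<rfloor>) at_top sequentially"
    and "(\<lambda>n. real (nat \<lfloor>m * real n + sqrt (real n)\<rfloor>) / real n) \<longlonglongrightarrow> m"
proof -
  have nonneg: "m * real n + sqrt (real n) \<ge> 0" for n
    using assms by simp
  have "filterlim (\<lambda>n. sqrt (real n) - 1) at_top sequentially"
    by real_asymp
  then have "filterlim (\<lambda>n. real (nat \<lfloor>m * real n + sqrt (real n)\<rfloor>)) at_top sequentially"
  proof (rule filterlim_at_top_mono)
    show "\<forall>\<^sub>F n in sequentially. sqrt (real n) - 1 \<le> real (nat \<lfloor>m * real n + sqrt (real n)\<rfloor>)"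
    proof (rule always_eventually, rule allI)
      fix n
      have "m * real n \<ge> 0" using assms by simp
      then show "sqrt (real n) - 1 \<le> real (nat \<lfloor>m * real n + sqrt (real n)\<rfloor>)"
        using nonneg[of n] by linarith
    qed
  qed
  then show "filterlim (\<lambda>n. nat \<lfloor>m * real n + sqrt (real n)\<rfloor>) at_top sequentially"
    by (simp add: filterlim_sequentially_iff_filterlim_real)
  have "(\<lambda>n. (m * real n + sqrt (real n) - 1) / real n) \<longlonglongrightarrow> m"
    and "(\<lambda>n. (m * real n + sqrt (real n)) / real n) \<longlonglongrightarrow> m"
    by real_asymp+
  then show "(\<lambda>n. real (nat \<lfloor>m * real n + sqrt (real n)\<rfloor>) / real n) \<longlonglongrightarrow> m"
  proof (rule tendsto_sandwich[rotated 2])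
    have "m * real n + sqrt (real n) - 1 \<le> real (nat \<lfloor>m * real n + sqrt (real n)\<rfloor>)"
      "real (nat \<lfloor>m * real n + sqrt (real n)\<rfloor>) \<le> m * real n + sqrt (real n)" for n
      using nonneg[of n] by linarith+
    then show "\<forall>\<^sub>F n in sequentially. (m * real n + sqrt (real n) - 1) / real n
        \<le> real (nat \<lfloor>m * real n + sqrt (real n)\<rfloor>) / real n"
      "\<forall>\<^sub>F n in sequentially. real (nat \<lfloor>m * real n + sqrt (real n)\<rfloor>) / real n
        \<le> (m * real n + sqrt (real n)) / real n"
      by (auto intro!: always_eventually divide_right_mono)
  qed
qed

text \<open>The weak law and the deterministic limit of j n / n share the same centre; each receives
  half of the error e.\<close>

lemma (in prob_space) tendsto_in_prob_clock:
  fixes \<xi> :: "nat \<Rightarrow> 'a \<Rightarrow> real" and j :: "nat \<Rightarrow> nat"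
  assumes indep: "indep_vars (\<lambda>_. borel) \<xi> UNIV"
    and id: "\<And>n. distr M borel (\<xi> n) = distr M borel (\<xi> 0)"
    and int: "integrable M (\<xi> 0)"
    and j: "(\<lambda>n. real (j n) / real n) \<longlonglongrightarrow> expectation (\<xi> 0)"
  shows "tendsto_in_prob M (\<lambda>n \<omega>. \<bar>real (j n) - (\<Sum>k<n. \<xi> k \<omega>)\<bar> / real n) 0"
proof (rule tendsto_in_probI)
  have [measurable]: "\<xi> k \<in> borel_measurable M" for k
    using indep by (auto simp: indep_vars_def)
  fix e :: real assume "e > 0"
  then show "(\<lambda>n. prob {\<omega>\<in>space M. e / 2 < \<bar>(\<Sum>k<n. \<xi> k \<omega>) / n - expectation (\<xi> 0)\<bar>}) \<longlonglongrightarrow> 0"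
    by (intro weak_law_of_large_numbers[OF indep id int]) simp
  have "\<forall>\<^sub>F n in sequentially. dist (real (j n) / real n) (expectation (\<xi> 0)) < e / 2"
    using \<open>e > 0\<close> by (intro tendstoD[OF j]) simp
  then show "\<forall>\<^sub>F n in sequentially. prob {\<omega>\<in>space M. e < \<bar>\<bar>real (j n) - (\<Sum>k<n. \<xi> k \<omega>)\<bar> / real n - 0\<bar>}
      \<le> prob {\<omega>\<in>space M. e / 2 < \<bar>(\<Sum>k<n. \<xi> k \<omega>) / n - expectation (\<xi> 0)\<bar>}"
  proof eventually_elim
    case (elim n)
    have "e / 2 < \<bar>(\<Sum>k<n. \<xi> k \<omega>) / n - expectation (\<xi> 0)\<bar>"
      if "e < \<bar>\<bar>real (j n) - (\<Sum>k<n. \<xi> k \<omega>)\<bar> / real n - 0\<bar>" for \<omega>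
    proof -
      have "\<bar>\<bar>real (j n) - (\<Sum>k<n. \<xi> k \<omega>)\<bar> / real n - 0\<bar> = \<bar>real (j n) / real n - (\<Sum>k<n. \<xi> k \<omega>) / n\<bar>"
        by (simp flip: diff_divide_distrib)
      then show ?thesis
        using that elim unfolding dist_real_def by linarith
    qed
    then have "{\<omega>\<in>space M. e < \<bar>\<bar>real (j n) - (\<Sum>k<n. \<xi> k \<omega>)\<bar> / real n - 0\<bar>}
      \<subseteq> {\<omega>\<in>space M. e / 2 < \<bar>(\<Sum>k<n. \<xi> k \<omega>) / n - expectation (\<xi> 0)\<bar>}"
      by blast
    then show ?case
      by (rule finite_measure_mono) measurable
  qed
qed

section \<open>Processes at sublinear word distance\<close>

context word_metric_group
begin

lemma tendsto_in_prob_imp_not_in_word_ball: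
  assumes "prob_space M" and \<Delta>: "tendsto_in_prob M \<Delta> 0"
    and [measurable]: "\<And>n. \<Delta> n \<in> borel_measurable M"
    and U: "\<And>n \<omega>. \<omega> \<in> space M \<Longrightarrow> U n \<omega> \<in> carrier G"
    and V: "\<And>n \<omega>. \<omega> \<in> space M \<Longrightarrow> V n \<omega> \<in> carrier G"
    and dist: "AE \<omega> in M. \<forall>n. real (wlen (inv (U n \<omega>) \<otimes> V n \<omega>)) / real n \<le> \<bar>\<Delta> n \<omega>\<bar>"
    and "\<eta> > 0"
  shows "(\<lambda>n. measure M {\<omega>\<in>space M. V n \<omega> \<notin> (\<lambda>w. U n \<omega> \<otimes> w) ` word_ball (nat \<lfloor>\<eta> * real n\<rfloor>)}) \<longlonglongrightarrow> 0"
proof (rule tendsto_sandwich[OF _ _ tendsto_const tendsto_in_probD[OF \<Delta> \<open>\<eta> > 0\<close>]])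
  interpret prob_space M by fact
  show "\<forall>\<^sub>F n in sequentially.
      measure M {\<omega>\<in>space M. V n \<omega> \<notin> (\<lambda>w. U n \<omega> \<otimes> w) ` word_ball (nat \<lfloor>\<eta> * real n\<rfloor>)}
      \<le> measure M {\<omega>\<in>space M. \<eta> < \<bar>\<Delta> n \<omega> - 0\<bar>}"
    using eventually_gt_at_top[of 0]
  proof eventually_elim
    case (elim n)
    show ?case
    proof (rule finite_measure_mono_AE)
      show "AE \<omega> in M. \<omega> \<in> {\<omega>\<in>space M. V n \<omega> \<notin> (\<lambda>w. U n \<omega> \<otimes> w) ` word_ball (nat \<lfloor>\<eta> * real n\<rfloor>)}
          \<longrightarrow> \<omega> \<in> {\<omega>\<in>space M. \<eta> < \<bar>\<Delta> n \<omega> - 0\<bar>}"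
        using dist
      proof eventually_elim
        case (elim \<omega>)
        show ?case
        proof
          assume \<omega>: "\<omega> \<in> {\<omega>\<in>space M. V n \<omega> \<notin> (\<lambda>w. U n \<omega> \<otimes> w) ` word_ball (nat \<lfloor>\<eta> * real n\<rfloor>)}"
          have c: "U n \<omega> \<in> carrier G" "V n \<omega> \<in> carrier G"
            using U V \<omega> by auto
          then have "V n \<omega> = U n \<omega> \<otimes> (inv (U n \<omega>) \<otimes> V n \<omega>)"
            by (simp flip: m_assoc)
          then have "inv (U n \<omega>) \<otimes> V n \<omega> \<notin> word_ball (nat \<lfloor>\<eta> * real n\<rfloor>)"
            using \<omega> by blast
          then have "nat \<lfloor>\<eta> * real n\<rfloor> < wlen (inv (U n \<omega>) \<otimes> V n \<omega>)"
            using c by (simp add: word_ball_def)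
          \<comment> \<open>A natural number above the floor of \<eta> n is above \<eta> n
            itself.\<close>
          then have "\<eta> * real n < real (wlen (inv (U n \<omega>) \<otimes> V n \<omega>))"
            by linarith
          then have "\<eta> < real (wlen (inv (U n \<omega>) \<otimes> V n \<omega>)) / real n"
            using \<open>0 < n\<close> by (simp add: field_simps)
          also have "\<dots> \<le> \<bar>\<Delta> n \<omega>\<bar>"
            using elim by blast
          finally show "\<omega> \<in> {\<omega>\<in>space M. \<eta> < \<bar>\<Delta> n \<omega> - 0\<bar>}"
            using \<omega> by simp
        qed
      qed
    qed measurable
  qed
qed simp

text \<open>The neighbourhoods are the balls x * \<open>word_ball k\<close> of the left invariant
  metric, whose size is at most \<open>(card S + 1) ^ k\<close> independently of x.\<close>

lemma covering_rate_le_word_metric: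
  assumes "prob_space M" and U_rate: "covering_rate M U a" and V_rate: "covering_rate M V b"
    and U: "\<And>n. U n \<in> measurable M (count_space (carrier G))"
    and V: "\<And>n. V n \<in> measurable M (count_space (carrier G))"
    and \<Delta>: "tendsto_in_prob M \<Delta> 0" "\<And>n. \<Delta> n \<in> borel_measurable M"
    and dist: "AE \<omega> in M. \<forall>n. real (wlen (inv (U n \<omega>) \<otimes> V n \<omega>)) / real n \<le> \<bar>\<Delta> n \<omega>\<bar>"
  shows "b \<le> a"
proof -
  interpret prob_space M by fact
  let ?nb = "\<lambda>k x. (\<lambda>w. x \<otimes> w) ` word_ball k"
  show ?thesis
  proof (rule covering_rate_le_nearby[OF U_rate V_rate, where nb = ?nb and L = "real (card S + 1)"])
    show "real (card (?nb k x)) \<le> real (card S + 1) ^ k" for k x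
      using card_image_le[OF finite_word_ball, of "\<lambda>w. x \<otimes> w" k] card_word_ball_le[of k]
      unfolding of_nat_power[symmetric] of_nat_le_iff by linarith
    show "finite (?nb k x)" for k x
      by (intro finite_imageI finite_word_ball)
    show "{\<omega>\<in>space M. U n \<omega> \<in> B} \<in> events" "{\<omega>\<in>space M. V n \<omega> \<in> B} \<in> events" for n B
      by (rule measurable_count_space_Collect[OF U], rule measurable_count_space_Collect[OF V])
    show "{\<omega>\<in>space M. V n \<omega> \<notin> ?nb k (U n \<omega>)} \<in> events" for k n
      by (rule sets_Collect_count_space2[OF countable_carrier U V])
    show "(\<lambda>n. prob {\<omega>\<in>space M. V n \<omega> \<notin> ?nb (nat \<lfloor>\<eta> * real n\<rfloor>) (U n \<omega>)}) \<longlonglongrightarrow> 0" if "\<eta> > 0" for \<eta>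
      using measurable_space[OF U] measurable_space[OF V]
      by (intro tendsto_in_prob_imp_not_in_word_ball[OF \<open>prob_space M\<close> \<Delta> _ _ dist that]) auto
  qed simp
qed

end

section \<open>Comparison of the stopped walk with the walk at deterministic times\<close>

lemma has_drift_imp_tendsto_in_prob:
  assumes "has_drift G S M Z c" "prob_space M" "\<And>n. Z n \<in> measurable M (count_space E)"
  shows "tendsto_in_prob M (\<lambda>n \<omega>. real (word_length G S (Z n \<omega>)) / real n) c"
proof -
  interpret prob_space M by fact
  have meas: "(\<lambda>\<omega>. real (word_length G S (Z n \<omega>)) / real n) \<in> borel_measurable M" for n
    by (rule measurable_compose[OF assms(3)]) simp
  show ?thesis
    unfolding tendsto_in_prob_def
    using AE_tendsto_imp_tendsto_in_probability[OF meas assms(1)[unfolded has_drift_def]] by blast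
qed

lemma (in word_metric_group) linearizes_imp_relations:
  assumes p: "random_walk G p N X"
    and lin: "linearizes G S r pt p M Y \<tau>"
    and u: "u \<in> {1..r}" and Y': "coloured_walk G r pt u M' Y'"
    and \<gamma>: "has_drift G S N X \<gamma>"
    and h: "has_entropy N (carrier G) (rw_kernel G p) \<one> X h"
    and \<gamma>': "has_drift G S M' (\<lambda>n \<omega>. fst (Y' n \<omega>)) \<gamma>'"
    and h': "has_entropy M' (coloured_states G r) (coloured_kernel G pt) (\<one>, u) Y' h'"
  shows "\<gamma> = (\<integral>\<omega>. real (the_enat (\<tau> 1 \<omega>)) \<partial>M) * \<gamma>' \<and>
         h = (\<integral>\<omega>. real (the_enat (\<tau> 1 \<omega>)) \<partial>M) * h'"
proof -
  let ?E = "coloured_states G r" and ?K = "coloured_kernel G pt"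
  define V where "V = (\<lambda>n \<omega>. fst (stopped Y (\<tau> n) \<omega>))"
  have step: "coloured_step G r pt" and nn: "nearest_neighbour G S r pt"
    and quasi: "quasi_irreducible G r pt" and Y: "coloured_walk G r pt 1 M Y"
    and stop: "\<And>n. stopping_time (natural_filtration M Y) (\<tau> n)"
    and \<tau>0: "AE \<omega> in M. \<tau> 0 \<omega> = 0"
    and V_walk: "random_walk G p M V"
    and indep: "prob_space.indep_vars M (\<lambda>_. borel) (time_increment \<tau>) UNIV"
    and id: "\<And>n. distr M borel (time_increment \<tau> n) = distr M borel (time_increment \<tau> 0)"
    and int: "integrable M (time_increment \<tau> 0)"
    using lin unfolding linearizes_def V_def by blast+
  interpret coloured_walk_group G r pt
    by unfold_locales (rule step, rule countable_carrier)
  have X_chain: "countable_markov_chain N (carrier G) (rw_kernel G p) \<one> X"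
    using p unfolding random_walk_def by (rule countable_markov_chain.intro[OF _ countable_carrier])
  have V_chain: "countable_markov_chain M (carrier G) (rw_kernel G p) \<one> V"
    using V_walk unfolding random_walk_def by (rule countable_markov_chain.intro[OF _ countable_carrier])
  interpret X: countable_markov_chain N "carrier G" "rw_kernel G p" "\<one>" X
    by (rule X_chain)
  interpret V: countable_markov_chain M "carrier G" "rw_kernel G p" "\<one>" V
    by (rule V_chain)
  interpret Y: countable_markov_chain M ?E ?K "(\<one>, 1)" Y
    using Y by (rule coloured_walk_chain)
  interpret Y': countable_markov_chain M' ?E ?K "(\<one>, u)" Y'
    using Y' by (rule coloured_walk_chain)
  have "1 \<in> {1..r}"
    using step by (auto simp: coloured_step_def)

  \<comment> \<open>V and X realize the same chain on different spaces, so their marginals agree: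
    the domination holds with constant 1 and the identity map.\<close>
  have le_X: "1 * measure M {\<omega>\<in>space M. V n \<omega> \<in> B} \<le> measure N {\<omega>\<in>space N. X n \<omega> \<in> (\<lambda>x. x) ` B}"
    if "B \<subseteq> carrier G" for n B
    using has_sum_unique[OF V.has_sum_kernel_power[OF that, of n] X.has_sum_kernel_power[OF that, of n]]
    by simp
  have V_rate: "covering_rate M V h"
    using X.entropy_imp_covering_rate[OF h] X.finite_measure_axioms zero_less_one inj_on_id2
      X.measurable_chain V.chain_in_states le_X
    by (rule covering_rate_transfer)
  have V_drift: "tendsto_in_prob M (\<lambda>n \<omega>. real (wlen (V n \<omega>)) / real n) \<gamma>"
    using has_drift_imp_tendsto_in_prob[OF \<gamma> X.prob_space_axioms X.measurable_chain]
      X.finite_measure_axioms zero_less_one X.measurable_chain V.chain_in_states le_X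
  proof (rule tendsto_in_prob_transfer[where D = 0])
    show "\<bar>real (wlen x) - real (wlen x)\<bar> \<le> 0" for x
      by simp
  qed

  \<comment> \<open>The colour chain leads from u to 1 in k steps, at some group element g with
    positive probability. This probability is the constant of domination between Y and Y', and
    translation by g is the map f in both transfers.\<close>
  obtain k where "kernel_power {1..r} (colour_matrix G pt) k u 1 > 0"
    using quasi u \<open>1 \<in> {1..r}\<close> unfolding quasi_irreducible_def irreducible_kernel_def by blast
  then obtain g where g: "g \<in> carrier G" and c: "kernel_power ?E ?K k (\<one>, u) (g, 1) > 0"
    using colour_kernel_power_pos_imp[OF Y' \<open>1 \<in> {1..r}\<close>] by blast
  have shift: "filterlim (\<lambda>n. k + n) at_top sequentially" "(\<lambda>n. real (k + n) / real n) \<longlonglongrightarrow> 1"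
    by real_asymp+
  have inj: "inj_on (translate G g) ?E"
    unfolding coloured_states_def using bij_betw_translate[OF g] by (rule bij_betw_imp_inj_on)
  have fst_Y: "fst (Y n \<omega>) \<in> carrier G" if "\<omega> \<in> space M" for n \<omega>
    using Y.chain_in_states[OF that, of n] by (auto simp: coloured_states_def)
  have fst_meas: "(\<lambda>\<omega>. fst (Y n \<omega>)) \<in> measurable M (count_space (carrier G))" for n
    by (rule measurable_compose[OF Y.measurable_chain]) (auto simp: coloured_states_def)
  have fst_meas': "(\<lambda>\<omega>. fst (Y' n \<omega>)) \<in> measurable M' (count_space (carrier G))" for n
    by (rule measurable_compose[OF Y'.measurable_chain]) (auto simp: coloured_states_def)
  \<comment> \<open>Y at time n is compared with Y' at time k + n; a fixed delay has slope 1 and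
    does not change the rate.\<close>
  have "covering_rate M' (\<lambda>n. Y' (k + n)) (1 * h')"
    by (rule covering_rate_reindex[OF Y'.entropy_imp_covering_rate[OF h'] zero_le_one shift])
  then have "covering_rate M Y (1 * h')"
    using Y'.finite_measure_axioms c inj Y'.measurable_chain Y.chain_in_states
      prob_translate_le[OF Y Y' g \<open>1 \<in> {1..r}\<close>]
    by (rule covering_rate_transfer)
  then have Y_rate: "covering_rate M (\<lambda>n \<omega>. fst (Y n \<omega>)) h'"
    using Y.measurable_chain unfolding coloured_states_def mult_1
    by (intro covering_rate_fst[OF _ V.finite_measure_axioms finite_atLeastAtMost])
  have "tendsto_in_prob M' (\<lambda>n \<omega>. real (wlen (fst (Y' (k + n) \<omega>))) / real n) (1 * \<gamma>')"
    using has_drift_imp_tendsto_in_prob[OF \<gamma>' Y'.prob_space_axioms fst_meas']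
      Y'.finite_measure_axioms measurable_compose[OF fst_meas'] zero_le_one shift
    by (rule tendsto_in_prob_reindex) simp
  then have Y_drift: "tendsto_in_prob M (\<lambda>n \<omega>. real (wlen (fst (Y n \<omega>))) / real n) (1 * \<gamma>')"
    using Y'.finite_measure_axioms c Y'.measurable_chain Y.chain_in_states
      prob_translate_le[OF Y Y' g \<open>1 \<in> {1..r}\<close>]
  proof (rule tendsto_in_prob_transfer[where D = "real (wlen g)"])
    fix x assume "x \<in> ?E"
    then have x: "fst x \<in> carrier G"
      by (auto simp: coloured_states_def)
    have "wlen (g \<otimes> fst x) \<le> wlen g + wlen (fst x)"
      using g x by (rule wlen_mult)
    moreover have "wlen (fst x) \<le> wlen g + wlen (g \<otimes> fst x)"
      using wlen_mult[of "inv g" "g \<otimes> fst x"] g x by (simp add: wlen_inv flip: m_assoc)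
    ultimately show "\<bar>real (wlen (fst (translate G g x))) - real (wlen (fst x))\<bar> \<le> real (wlen g)"
      by (simp add: translate_def)
  qed

  define m where "m = (\<integral>\<omega>. real (the_enat (\<tau> 1 \<omega>)) \<partial>M)"
  \<comment> \<open>Two forms of the mean: the increment enters the weak law, while the integral of
    \<tau> 1 is visibly nonnegative.\<close>
  have m_eq: "m = (\<integral>\<omega>. time_increment \<tau> 0 \<omega> \<partial>M)"
    unfolding m_def
  proof (rule integral_cong_AE)
    show "AE \<omega> in M. real (the_enat (\<tau> 1 \<omega>)) = time_increment \<tau> 0 \<omega>"
      using \<tau>0 by eventually_elim (simp add: time_increment_def zero_enat_def)
    show "(\<lambda>\<omega>. real (the_enat (\<tau> 1 \<omega>))) \<in> borel_measurable M"
      by (rule borel_measurable_the_enat_natural_stopping_time[OF Y.measurable_chain stop])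
  qed (use int in simp)
  have "m \<ge> 0"
    unfolding m_def by (rule Bochner_Integration.integral_nonneg) simp
  \<comment> \<open>The square root makes j diverge even when m = 0.\<close>
  define j where "j = (\<lambda>n. nat \<lfloor>m * real n + sqrt (real n)\<rfloor>)"
  have j: "filterlim j at_top sequentially" "(\<lambda>n. real (j n) / real n) \<longlonglongrightarrow> m"
    unfolding j_def using clock_limits[OF \<open>m \<ge> 0\<close>] by blast+
  \<comment> \<open>U is the walk at the deterministic time j n and V the walk at the random time
    \<tau> n; \<Delta> below is the time gap per step, which bounds their word distance.\<close>
  define U where "U = (\<lambda>n \<omega>. fst (Y (j n) \<omega>))"
  have U_meas: "U n \<in> measurable M (count_space (carrier G))" for n
    unfolding U_def by (rule fst_meas)
  have U_in: "U n \<omega> \<in> carrier G" if "\<omega> \<in> space M" for n \<omega>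
    unfolding U_def using that by (rule fst_Y)
  have U_rate: "covering_rate M U (m * h')"
    unfolding U_def using covering_rate_reindex[OF Y_rate \<open>m \<ge> 0\<close> j] .
  have U_drift: "tendsto_in_prob M (\<lambda>n \<omega>. real (wlen (U n \<omega>)) / real n) (m * \<gamma>')"
    unfolding U_def
    using Y_drift[unfolded mult_1] V.finite_measure_axioms measurable_compose[OF fst_meas] \<open>m \<ge> 0\<close> j
    by (rule tendsto_in_prob_reindex) simp

  define \<Delta> where "\<Delta> = (\<lambda>n \<omega>. \<bar>real (j n) - (\<Sum>k<n. time_increment \<tau> k \<omega>)\<bar> / real n)"
  have \<Delta>_lim: "tendsto_in_prob M \<Delta> 0"
    unfolding \<Delta>_def by (rule V.tendsto_in_prob_clock[OF indep id int j(2)[unfolded m_eq]])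
  have [measurable]: "time_increment \<tau> i \<in> borel_measurable M" for i
    using indep by (auto simp: V.indep_vars_def)
  have \<Delta>_meas: "\<Delta> n \<in> borel_measurable M" for n
    unfolding \<Delta>_def by measurable
  \<comment> \<open>An increment of length above 1 is not a generator, hence lies outside the
    support, and its kernel value is 0.\<close>
  have "AE \<omega> in M. \<forall>n. wlen (inv (fst (Y n \<omega>)) \<otimes> fst (Y (Suc n) \<omega>)) \<le> 1"
  proof (rule Y.AE_chain_transition)
    fix z y assume zy: "z \<in> ?E" "y \<in> ?E" "\<not> wlen (inv (fst z) \<otimes> fst y) \<le> 1"
    then have "inv (fst z) \<otimes> fst y \<notin> coloured_support G r pt"
      using wlen_generator nn unfolding nearest_neighbour_def by blast
    moreover have "inv (fst z) \<otimes> fst y \<in> carrier G" "snd z \<in> {1..r}" "snd y \<in> {1..r}"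
      using zy by (auto simp: coloured_states_def)
    ultimately show "?K z y = 0"
      unfolding coloured_support_def coloured_kernel_def by blast
  qed
  then have dist: "AE \<omega> in M. \<forall>n. real (wlen (inv (U n \<omega>) \<otimes> V n \<omega>)) / real n \<le> \<bar>\<Delta> n \<omega>\<bar>"
    using \<tau>0 AE_space
  proof eventually_elim
    case (elim \<omega>)
    show ?case
    proof
      fix n
      \<comment> \<open>The increments telescope because \<tau> 0 = 0 at this \<omega>. For n = 0
        the quotients below are 0 by the convention for division.\<close>
      have "(\<Sum>k<n. time_increment \<tau> k \<omega>) = real (the_enat (\<tau> n \<omega>))"
        using elim(2) unfolding time_increment_def
        by (simp add: sum_lessThan_telescope[of "\<lambda>k. real (the_enat (\<tau> k \<omega>))"] zero_enat_def)
      moreover have "real (wlen (inv (U n \<omega>) \<otimes> V n \<omega>)) \<le> \<bar>real (j n) - real (the_enat (\<tau> n \<omega>))\<bar>"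
        unfolding U_def V_def stopped_def
        using fst_Y[OF elim(3)] elim(1) by (intro wlen_path_le) auto
      ultimately show "real (wlen (inv (U n \<omega>) \<otimes> V n \<omega>)) / real n \<le> \<bar>\<Delta> n \<omega>\<bar>"
        by (simp add: \<Delta>_def divide_right_mono)
    qed
  qed
  then have dist': "AE \<omega> in M. \<forall>n. real (wlen (inv (V n \<omega>) \<otimes> U n \<omega>)) / real n \<le> \<bar>\<Delta> n \<omega>\<bar>"
    using AE_space
  proof eventually_elim
    case (elim \<omega>)
    have "wlen (inv (V n \<omega>) \<otimes> U n \<omega>) = wlen (inv (U n \<omega>) \<otimes> V n \<omega>)" for n
      using wlen_dist_commute V.chain_in_states[OF elim(2)] U_in[OF elim(2)] by blast
    then show ?case
      using elim(1) by simp
  qed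

  \<comment> \<open>The covering comparison is one-sided; exchanging the roles of U and V gives the
    reverse inequality.\<close>
  have "h \<le> m * h'"
    using V.prob_space_axioms U_rate V_rate U_meas V.measurable_chain \<Delta>_lim \<Delta>_meas dist
    by (rule covering_rate_le_word_metric)
  moreover have "m * h' \<le> h"
    using V.prob_space_axioms V_rate U_rate V.measurable_chain U_meas \<Delta>_lim \<Delta>_meas dist'
    by (rule covering_rate_le_word_metric)
  moreover have "m * \<gamma>' = \<gamma>"
    using U_drift V_drift \<Delta>_lim
  proof (rule V.tendsto_in_prob_unique)
    show "(\<lambda>\<omega>. real (wlen (U n \<omega>)) / real n) \<in> borel_measurable M" for n
      by (rule measurable_compose[OF U_meas]) simp
    show "(\<lambda>\<omega>. real (wlen (V n \<omega>)) / real n) \<in> borel_measurable M" for n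
      by (rule measurable_compose[OF V.measurable_chain]) simp
    show "AE \<omega> in M. \<forall>n. \<bar>real (wlen (U n \<omega>)) / real n - real (wlen (V n \<omega>)) / real n\<bar> \<le> \<bar>\<Delta> n \<omega>\<bar>"
      using dist AE_space
    proof eventually_elim
      case (elim \<omega>)
      show ?case
      proof
        fix n
        have "U n \<omega> \<in> carrier G" "V n \<omega> \<in> carrier G"
          using elim U_in V.chain_in_states by auto
        then have "\<bar>real (wlen (U n \<omega>)) - real (wlen (V n \<omega>))\<bar> / real n
            \<le> real (wlen (inv (U n \<omega>) \<otimes> V n \<omega>)) / real n"
          by (intro divide_right_mono abs_wlen_diff_le) auto
        also have "\<dots> \<le> \<bar>\<Delta> n \<omega>\<bar>"
          using elim(1) by blast
        finally show "\<bar>real (wlen (U n \<omega>)) / real n - real (wlen (V n \<omega>)) / real n\<bar> \<le> \<bar>\<Delta> n \<omega>\<bar>"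
          unfolding diff_divide_distrib[symmetric] abs_divide abs_of_nat .
      qed
    qed
  qed (rule \<Delta>_meas)
  ultimately show ?thesis
    unfolding m_def[symmetric] by simp
qed

theorem mainTheorem3:
  fixes G :: "('a, 'b) monoid_scheme" and S :: "'a set"
    and p :: "'a pmf" and N :: "'n measure" and X :: "nat \<Rightarrow> 'n \<Rightarrow> 'a"
    and r :: nat and pt :: "'a \<Rightarrow> nat \<Rightarrow> nat \<Rightarrow> real"
    and M :: "'m measure" and Y :: "nat \<Rightarrow> 'm \<Rightarrow> 'a \<times> nat" and \<tau> :: "nat \<Rightarrow> 'm \<Rightarrow> enat"
    and u :: nat and M' :: "'k measure" and Y' :: "nat \<Rightarrow> 'k \<Rightarrow> 'a \<times> nat"
    and \<gamma> h \<gamma>' h' :: real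
  assumes "group G"
    and "finite S" and "S \<subseteq> carrier G" and "generate G S = carrier G"
    and "\<forall>s\<in>S. inv\<^bsub>G\<^esub> s \<in> S"
    and "finitely_supported_step G p" and "random_walk G p N X"
    and "linearizes G S r pt p M Y \<tau>"
    (* Y' is the same coloured walk started from an arbitrary colour u; M' = M, Y' = Y and u = 1
       is a possible choice *)
    and "u \<in> {1..r}" and "coloured_walk G r pt u M' Y'"
    and "has_drift G S N X \<gamma>"
    and "has_entropy N (carrier G) (rw_kernel G p) \<one>\<^bsub>G\<^esub> X h"
    and "has_drift G S M' (\<lambda>n \<omega>. fst (Y' n \<omega>)) \<gamma>'"
    and "has_entropy M' (coloured_states G r) (coloured_kernel G pt) (\<one>\<^bsub>G\<^esub>, u) Y' h'"
  shows "\<gamma> = (\<integral>\<omega>. real (the_enat (\<tau> 1 \<omega>)) \<partial>M) * \<gamma>' \<and>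
         h = (\<integral>\<omega>. real (the_enat (\<tau> 1 \<omega>)) \<partial>M) * h'"
proof -
  interpret word_metric_group G S
    using assms(1-5) by (auto simp: word_metric_group_def word_metric_group_axioms_def)
  show ?thesis
    using assms(7-14) by (rule linearizes_imp_relations)
qed

end
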